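(* Suppose $T$ is a tree on $n\ge 3$ vertices with at least $\rho\binom{n-1}{2}$ paths of length $2$ for some nonnegative real number $\rho$. Then the peak location of the sequence of normalized coefficients $d_0(T),d_1(T),\dots,d_{n-2}(T)$ is at most $\left\lceil\frac{2-\rho}{3-\rho}n\right\rceil$. In particular, since $\rho=0$ applies to every tree, the peak location is at most $\left\lceil\frac{2}{3}n\right\rceil$ for every tree on $n$ vertices.
   Context: A tree is a finite simple undirected connected graph without cycles. The distance matrix $\mathcal{D}(T)$ is indexed by the vertices of $T$, with $(i,j)$-entry equal to the length (number of edges) of a shortest path between $v_i$ and $v_j$. $\delta_k(T)$ denotes the coefficient of $x^k$ in $\det(\mathcal{D}(T)-xI)$, and for $0\le k\le n-2$ the normalized coefficients are $d_k(T)=\frac{1}{2^{n-2}}2^k|\delta_k(T)|$. The number of paths of length $2$ in $T$ is the number of subtrees (subgraphs) of $T$ isomorphic to the path $P_3$ on three vertices. A sequence $a_0,\dots,a_m$ of real numbers is unimodal if there is a $k$ such that $a_{i-1}\le a_i$ for $i\le k$ and $a_i\ge a_{i+1}$ for $i\ge k$ (for all indices for which these make sense). The sequence $d_0(T),\dots,d_{n-2}(T)$ is unimodal for every tree $T$. A peak location of a unimodal sequence is such an index $k$, equivalently an index at which the maximum of the sequence is attained; "the peak location is at most $j$" means that every such $k$ satisfies $k\le j$. *)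

theory Defs
  imports
    "Jordan_Normal_Form.Determinant"
    "Graph_Theory.Graph_Theory"
begin

text \<open>
  A finite simple undirected graph is a \<open>pair_graph\<close>: a finite loop-free symmetric digraph whose
  arcs are pairs of vertices, so that an edge \<open>uv\<close> is the pair of arcs \<open>(u, v)\<close>, \<open>(v, u)\<close>.
  The library's \<open>tree\<close> is meant for digraphs and counts \<open>u, v, u\<close> as a cycle, hence no symmetric
  graph with an edge satisfies it; the cycles of the undirected graph are those of length at least 3.
\<close>

definition undirected_tree :: "'a pair_pre_digraph \<Rightarrow> bool" where
  "undirected_tree T \<longleftrightarrow>
     pair_graph T \<and> Digraph_Component.connected (with_proj T) \<and>
     \<not> (\<exists>p. pre_digraph.cycle (with_proj T) p \<and> 3 \<le> length p)"

definition graph_dist :: "'a pair_pre_digraph \<Rightarrow> 'a \<Rightarrow> 'a \<Rightarrow> nat" where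
  "graph_dist T u v = (LEAST l. \<exists>p. pre_digraph.apath (with_proj T) u p v \<and> length p = l)"

definition path_graph3 :: "nat pair_pre_digraph" where
  "path_graph3 = \<lparr> pverts = {0, 1, 2}, parcs = {(0, 1), (1, 0), (1, 2), (2, 1)} \<rparr>"

definition num_paths2 :: "'a pair_pre_digraph \<Rightarrow> nat" where
  "num_paths2 T =
     card {H :: 'a pair_pre_digraph.
             subgraph (with_proj H) (with_proj T) \<and>
             digraph_iso (with_proj H) (with_proj path_graph3)}"

text \<open>The list \<open>vs\<close> enumerates the vertices; it fixes the order of the rows and columns.\<close>

definition distance_matrix :: "'a pair_pre_digraph \<Rightarrow> 'a list \<Rightarrow> real mat" where
  "distance_matrix T vs =
     mat (length vs) (length vs) (\<lambda>(i, j). real (graph_dist T (vs ! i) (vs ! j)))"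

text \<open>
  This is \<open>det (D - x I)\<close>, which differs from the library's \<open>char_poly D\<close>, i.e. \<open>det (x I - D)\<close>,
  by the sign \<open>(-1)^n\<close>.
\<close>

definition distance_poly :: "'a pair_pre_digraph \<Rightarrow> 'a list \<Rightarrow> real poly" where
  "distance_poly T vs =
     Determinant.det (map_mat (\<lambda>a. [:a:]) (distance_matrix T vs) - [:0, 1:] \<cdot>\<^sub>m 1\<^sub>m (length vs))"

definition delta_coeff :: "'a pair_pre_digraph \<Rightarrow> 'a list \<Rightarrow> nat \<Rightarrow> real" where
  "delta_coeff T vs k = coeff (distance_poly T vs) k"

definition normalized_coeff :: "'a pair_pre_digraph \<Rightarrow> 'a list \<Rightarrow> nat \<Rightarrow> real" where
  "normalized_coeff T vs k = 1 / 2 ^ (length vs - 2) * 2 ^ k * \<bar>delta_coeff T vs k\<bar>"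

text \<open>
  \<open>peak_location a m k\<close>: the index \<open>k\<close> witnesses that the finite sequence \<open>a 0, \<dots>, a m\<close> is
  unimodal. A sequence with a plateau at its maximum has several peak locations.
\<close>

definition peak_location :: "(nat \<Rightarrow> real) \<Rightarrow> nat \<Rightarrow> nat \<Rightarrow> bool" where
  "peak_location a m k \<longleftrightarrow>
     k \<le> m \<and>
     (\<forall>i. 1 \<le> i \<and> i \<le> k \<longrightarrow> a (i - 1) \<le> a i) \<and>
     (\<forall>i. k \<le> i \<and> i + 1 \<le> m \<longrightarrow> a i \<ge> a (i + 1))"

end

theory Submission
  imports Defs "Jordan_Normal_Form.Schur_Decomposition"
begin

text \<open>
  The Laplacian \<open>L\<close> of the tree and \<open>\<tau> v = 2 - deg v\<close> satisfy \<open>L D = \<tau> 1\<^sup>T - 2 I\<close> and \<open>\<tau>\<^sup>T D = (n - 1) 1\<^sup>T\<close>.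
  Hence \<open>D\<close> is invertible with \<open>D\<^bsup>-1\<^esup> = \<tau> \<tau>\<^sup>T / (2 (n - 1)) - L / 2\<close> (Graham and Lovasz), and its quadratic
  form is nonpositive on the hyperplane of vectors with sum zero. Since \<open>D\<close> has trace zero, it has
  exactly one positive eigenvalue. Up to a constant factor, \<open>\<bar>\<delta>\<^sub>k\<bar>\<close> is the elementary symmetric function
  \<open>E\<^sub>k\<close> of the negated reciprocals of the eigenvalues. These are positive except for one, and their
  own reciprocals sum to zero, so \<open>E\<^sub>k > 0\<close> for \<open>k \<le> n - 2\<close>, and Chebyshev's sum inequality gives
  \<open>n (k + 1) E\<^bsub>k+1\<^esub> \<le> (n - k) E\<^sub>1 E\<^sub>k\<close>. Finally \<open>E\<^sub>1\<close> is minus the trace of the inverse, which depends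
  only on \<open>n\<close> and the number of paths of length 2.
\<close>

section \<open>Spectra of real symmetric matrices\<close>

definition mat_trace :: "'a :: comm_monoid_add mat \<Rightarrow> 'a" where
  "mat_trace A = (\<Sum>i<dim_row A. A $$ (i, i))"

lemma mat_trace_mult_commute:
  fixes A B :: "'a :: comm_semiring_0 mat"
  assumes "A \<in> carrier_mat n n" "B \<in> carrier_mat n n"
  shows "mat_trace (A * B) = mat_trace (B * A)"
proof -
  have "mat_trace (A * B) = (\<Sum>i<n. \<Sum>j<n. A $$ (i, j) * B $$ (j, i))"
    using assms by (simp add: mat_trace_def scalar_prod_def atLeast0LessThan)
  also have "\<dots> = (\<Sum>j<n. \<Sum>i<n. B $$ (j, i) * A $$ (i, j))"
    by (subst sum.swap) (simp add: mult.commute)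
  also have "\<dots> = mat_trace (B * A)"
    using assms by (simp add: mat_trace_def scalar_prod_def atLeast0LessThan)
  finally show ?thesis .
qed

text \<open>Trace is invariant under similarity, and a Schur decomposition puts the list
  \<open>es\<close> on the diagonal. This serves both the distance matrix, whose trace is zero, and
  its inverse.\<close>

lemma mat_trace_eq_sum_roots:
  fixes A :: "'a :: conjugatable_ordered_field mat"
  assumes A: "A \<in> carrier_mat n n" and cp: "char_poly A = (\<Prod>e\<leftarrow>es. [:- e, 1:])"
  shows "mat_trace A = sum_list es"
proof -
  obtain B P Q where "schur_decomposition A es = (B, P, Q)"
    by (cases "schur_decomposition A es") auto
  from schur_decomposition[OF A cp this]
  have sim: "similar_mat_wit A B P Q" and diag: "diag_mat B = es"
    by auto
  from similar_mat_witD2[OF A sim] have carr: "B \<in> carrier_mat n n" "P \<in> carrier_mat n n"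
    "Q \<in> carrier_mat n n" and QP: "Q * P = 1\<^sub>m n" and AB: "A = P * B * Q"
    by auto
  have "mat_trace A = mat_trace (Q * (P * B))"
    unfolding AB using carr by (intro mat_trace_mult_commute) auto
  also have "Q * (P * B) = B"
    using carr QP assoc_mult_mat[of Q n n P n B n] by simp
  also have "mat_trace B = sum_list es"
    using carr by (simp add: mat_trace_def diag[symmetric] diag_mat_def interv_sum_list_conv_sum_set_nat atLeast0LessThan)
  finally show ?thesis .
qed

lemma poly_char_poly:
  fixes A :: "'a :: field mat"
  assumes "A \<in> carrier_mat n n"
  shows "poly (char_poly A) k = det (k \<cdot>\<^sub>m 1\<^sub>m n - A)"
proof -
  have "- char_matrix A k = k \<cdot>\<^sub>m 1\<^sub>m n - A"
    using assms by (intro eq_matI) (auto simp: char_matrix_def)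
  then show ?thesis
    using char_poly_matrix[OF assms, of k] by simp
qed

lemma poly_prod_list_linear: "poly (\<Prod>e\<leftarrow>es. [:- e, 1:]) (k :: 'a :: comm_ring_1) = (\<Prod>e\<leftarrow>es. k - e)"
  by (induction es) (auto simp: algebra_simps)

lemma char_poly_roots_length:
  fixes A :: "'a :: field mat"
  assumes "A \<in> carrier_mat n n" "char_poly A = (\<Prod>e\<leftarrow>es. [:- e, 1:])"
  shows "length es = n"
proof -
  have "degree (\<Prod>e\<leftarrow>es. [:- e, 1:] :: 'a poly) = length es"
    by (rule degree_linear_factors)
  then show ?thesis using degree_monic_char_poly[OF assms(1)] assms(2) by simp
qed

text \<open>Factoring \<open>R\<close> out of \<open>k I - R\<close> leaves \<open>-k\<close> times
  \<open>1/k I - A\<close>, so the roots of one polynomial are the reciprocals of those of the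
  other, with multiplicity.\<close>

lemma char_poly_left_inverse:
  fixes A R :: "'a :: field_char_0 mat"
  assumes A: "A \<in> carrier_mat n n" and R: "R \<in> carrier_mat n n" and inv: "R * A = 1\<^sub>m n"
    and cp: "char_poly A = (\<Prod>e\<leftarrow>es. [:- e, 1:])"
  shows "0 \<notin> set es" and "char_poly R = (\<Prod>e\<leftarrow>es. [:- inverse e, 1:])"
proof -
  have len: "length es = n"
    using A cp by (rule char_poly_roots_length)
  have "det R * det A = 1"
    using det_mult[OF R A] inv by simp
  \<comment> \<open>The determinant is read off from the characteristic polynomial at 0.\<close>
  moreover have detA: "det A = prod_list es"
  proof -
    have "det (- A) = (\<Prod>e\<leftarrow>es. - e)"
    proof -
      have "0 \<cdot>\<^sub>m 1\<^sub>m n - A = - A"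
        using A by (intro eq_matI) auto
      then show ?thesis
        using poly_char_poly[OF A, of 0] by (simp add: cp poly_prod_list_linear)
    qed
    also have "\<dots> = (- 1) ^ length es * prod_list es"
      by (induction es) auto
    also have "- A = (- 1) \<cdot>\<^sub>m A"
      by (intro eq_matI) auto
    finally show ?thesis using A by (simp add: len)
  qed
  ultimately have dR: "det R * prod_list es = 1"
    by simp
  then show nz: "0 \<notin> set es"
    by (metis mult_zero_right prod_list_zero_iff zero_neq_one)
  have "poly (char_poly R) k = poly (\<Prod>e\<leftarrow>es. [:- inverse e, 1:]) k" if k: "k \<noteq> 0" for k
  proof -
    have "k \<cdot>\<^sub>m 1\<^sub>m n - R = R * ((- k) \<cdot>\<^sub>m (inverse k \<cdot>\<^sub>m 1\<^sub>m n - A))"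
    proof -
      have "(- k) \<cdot>\<^sub>m (inverse k \<cdot>\<^sub>m 1\<^sub>m n - A) = k \<cdot>\<^sub>m A - 1\<^sub>m n"
        using A k by (intro eq_matI) (auto simp: field_simps)
      moreover have "R * (k \<cdot>\<^sub>m A - 1\<^sub>m n) = k \<cdot>\<^sub>m 1\<^sub>m n - R"
        using A R by (subst mult_minus_distrib_mat[of _ n n _ n])
          (auto simp: mult_smult_distrib[of _ n n _ n] inv)
      ultimately show ?thesis by simp
    qed
    then have "poly (char_poly R) k = det (R * ((- k) \<cdot>\<^sub>m (inverse k \<cdot>\<^sub>m 1\<^sub>m n - A)))"
      by (simp add: poly_char_poly[OF R])
    also have "\<dots> = det R * det ((- k) \<cdot>\<^sub>m (inverse k \<cdot>\<^sub>m 1\<^sub>m n - A))"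
      by (rule det_mult[OF R]) (use A in auto)
    also have "det ((- k) \<cdot>\<^sub>m (inverse k \<cdot>\<^sub>m 1\<^sub>m n - A)) = (- k) ^ n * (\<Prod>e\<leftarrow>es. inverse k - e)"
      using A poly_char_poly[OF A, of "inverse k"] by (simp add: cp poly_prod_list_linear)
    also have "(- k) ^ n * (\<Prod>e\<leftarrow>es. inverse k - e) = prod_list es * (\<Prod>e\<leftarrow>es. k - inverse e)"
      unfolding len[symmetric] using nz
      by (induction es) (use k in \<open>auto simp: field_simps\<close>)
    also have "det R * (prod_list es * (\<Prod>e\<leftarrow>es. k - inverse e)) = (\<Prod>e\<leftarrow>es. k - inverse e)"
      using dR by (simp add: mult.assoc[symmetric])
    also have "\<dots> = poly (\<Prod>e\<leftarrow>es. [:- inverse e, 1:]) k"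
      by (induction es) (auto simp: algebra_simps)
    finally show ?thesis .
  qed
  \<comment> \<open>The substitution \<open>inverse k\<close> excludes \<open>k = 0\<close>;
    agreement at the infinitely many other points still forces equality of polynomials.\<close>
  then have "poly (char_poly R - (\<Prod>e\<leftarrow>es. [:- inverse e, 1:])) k = 0" if "k \<noteq> 0" for k
    unfolding poly_diff right_minus_eq using that by blast
  then have "UNIV - {0} \<subseteq> {k. poly (char_poly R - (\<Prod>e\<leftarrow>es. [:- inverse e, 1:])) k = 0}"
    by blast
  moreover have "infinite (UNIV - {0 :: 'a})"
    by (simp add: infinite_UNIV_char_0)
  ultimately have "infinite {k. poly (char_poly R - (\<Prod>e\<leftarrow>es. [:- inverse e, 1:])) k = 0}"
    by (rule infinite_super)
  then have "char_poly R - (\<Prod>e\<leftarrow>es. [:- inverse e, 1:]) = 0"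
    using poly_roots_finite[of "char_poly R - (\<Prod>e\<leftarrow>es. [:- inverse e, 1:])"] by argo
  then show "char_poly R = (\<Prod>e\<leftarrow>es. [:- inverse e, 1:])"
    by simp
qed

text \<open>Over the complex numbers a factorization always exists; symmetry then makes every root
  real.\<close>

lemma real_symmetric_char_poly_factorized:
  fixes A :: "real mat"
  assumes A: "A \<in> carrier_mat n n"
    and sym: "\<And>i j. i < n \<Longrightarrow> j < n \<Longrightarrow> A $$ (i, j) = A $$ (j, i)"
  shows "\<exists>es. char_poly A = (\<Prod>e\<leftarrow>es. [:- e, 1:])"
proof -
  let ?A = "map_mat complex_of_real A"
  have cA: "?A \<in> carrier_mat n n" using A by simp
  obtain as where as: "char_poly ?A = (\<Prod>a\<leftarrow>as. [:- a, 1:])"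
    using char_poly_factorized[OF cA] by blast
  have real: "a \<in> \<real>" if a: "a \<in> set as" for a
  proof -
    have "eigenvalue ?A a"
      unfolding eigenvalue_root_char_poly[OF cA] as poly_prod_list_linear
      using a by (auto simp: prod_list_zero_iff)
    then obtain v where v: "v \<in> carrier_vec n" "v \<noteq> 0\<^sub>v n" "?A *\<^sub>v v = a \<cdot>\<^sub>v v"
      using A by (auto simp: eigenvalue_def eigenvector_def)
    have ev: "(\<Sum>j<n. of_real (A $$ (i, j)) * v $ j) = a * v $ i" if "i < n" for i
    proof -
      have "(?A *\<^sub>v v) $ i = (\<Sum>j<n. of_real (A $$ (i, j)) * v $ j)"
        using that A v(1) by (simp add: scalar_prod_def atLeast0LessThan)
      moreover have "(?A *\<^sub>v v) $ i = a * v $ i"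
        unfolding v(3) using that v(1) by simp
      ultimately show ?thesis by simp
    qed
    \<comment> \<open>The Hermitian form at \<open>v\<close>: it is \<open>a\<close> times the
      squared norm of \<open>v\<close>, and by symmetry it equals its own conjugate, so
      \<open>a\<close> is real.\<close>
    define q where "q = (\<Sum>i<n. \<Sum>j<n. cnj (v $ i) * of_real (A $$ (i, j)) * v $ j)"
    have q1: "q = a * of_real (\<Sum>i<n. (cmod (v $ i))\<^sup>2)"
    proof -
      have "q = (\<Sum>i<n. cnj (v $ i) * (\<Sum>j<n. of_real (A $$ (i, j)) * v $ j))"
        by (simp add: q_def sum_distrib_left mult.assoc)
      also have "\<dots> = (\<Sum>i<n. a * of_real ((cmod (v $ i))\<^sup>2))"
      proof (intro sum.cong refl)
        fix i assume "i \<in> {..<n}"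
        then have "cnj (v $ i) * (\<Sum>j<n. of_real (A $$ (i, j)) * v $ j) = cnj (v $ i) * (a * v $ i)"
          by (simp only: ev lessThan_iff)
        also have "\<dots> = a * of_real ((cmod (v $ i))\<^sup>2)"
          unfolding complex_norm_square by (simp only: mult_ac)
        finally show "cnj (v $ i) * (\<Sum>j<n. of_real (A $$ (i, j)) * v $ j) = a * of_real ((cmod (v $ i))\<^sup>2)" .
      qed
      finally show ?thesis by (simp add: sum_distrib_left)
    qed
    have "cnj q = (\<Sum>i<n. \<Sum>j<n. v $ i * of_real (A $$ (i, j)) * cnj (v $ j))"
      by (simp add: q_def)
    also have "\<dots> = (\<Sum>j<n. \<Sum>i<n. v $ i * of_real (A $$ (i, j)) * cnj (v $ j))"
      by (rule sum.swap)
    also have "\<dots> = q"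
      unfolding q_def by (intro sum.cong refl) (simp add: sym mult_ac)
    finally have "q \<in> \<real>"
      by (simp add: Reals_cnj_iff)
    moreover have "(\<Sum>i<n. (cmod (v $ i))\<^sup>2) \<noteq> 0"
    proof
      assume "(\<Sum>i<n. (cmod (v $ i))\<^sup>2) = 0"
      then have "\<forall>i<n. v $ i = 0"
        by (subst (asm) sum_nonneg_eq_0_iff) auto
      then show False using v by auto
    qed
    ultimately show "a \<in> \<real>"
      unfolding q1 by (metis Reals_divide Reals_of_real nonzero_mult_div_cancel_right of_real_eq_0_iff)
  qed
  have "as = map of_real (map Re as)"
    using real by (induction as) auto
  then obtain es where es: "as = map of_real es" by blast
  \<comment> \<open>Embedding the coefficients into the complex numbers is injective on polynomials,
    so the factorization descends to the reals.\<close>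
  interpret of_real_poly_hom: map_poly_inj_idom_hom "of_real :: real \<Rightarrow> complex" ..
  have "map_poly of_real (char_poly A) = char_poly ?A"
    by (rule of_real_hom.char_poly_hom[OF A, symmetric])
  also have "\<dots> = map_poly of_real (\<Prod>e\<leftarrow>es. [:- e, 1:])"
    unfolding as es by (simp add: of_real_poly_hom.hom_prod_list o_def del: mult_pCons_left)
  finally have "char_poly A = (\<Prod>e\<leftarrow>es. [:- e, 1:])"
    by (rule of_real_poly_hom.injectivity)
  then show ?thesis ..
qed

text \<open>
  A Schur decomposition with \<open>e1\<close>, \<open>e2\<close> at the head of the diagonal gives an invariant plane; by symmetry
  the complement of the first eigenvector in this plane is an eigenvector for \<open>e2\<close>, even if \<open>e1 = e2\<close>.
\<close>

lemma real_symmetric_orthogonal_eigenvectors: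
  fixes A :: "real mat"
  assumes A: "A \<in> carrier_mat n n"
    and sym: "\<And>i j. i < n \<Longrightarrow> j < n \<Longrightarrow> A $$ (i, j) = A $$ (j, i)"
    and cp: "char_poly A = (\<Prod>e\<leftarrow>e1 # e2 # es. [:- e, 1:])"
  obtains v w :: "nat \<Rightarrow> real" where
    "\<And>i. i < n \<Longrightarrow> (\<Sum>j<n. A $$ (i, j) * v j) = e1 * v i"
    "\<And>i. i < n \<Longrightarrow> (\<Sum>j<n. A $$ (i, j) * w j) = e2 * w i"
    "(\<Sum>i<n. v i * w i) = 0" "\<exists>i<n. v i \<noteq> 0" "\<exists>i<n. w i \<noteq> 0"
proof -
  have n: "n = Suc (Suc (length es))"
    using char_poly_roots_length[OF A cp] by simp
  then have n01: "0 < n" "1 < n" by simp_all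
  obtain B P Q where "schur_decomposition A (e1 # e2 # es) = (B, P, Q)"
    by (cases "schur_decomposition A (e1 # e2 # es)") auto
  from schur_decomposition[OF A cp this]
  have sim: "similar_mat_wit A B P Q" and ut: "upper_triangular B"
    and diag: "diag_mat B = e1 # e2 # es"
    by auto
  from similar_mat_witD2[OF A sim] have carr: "B \<in> carrier_mat n n" "P \<in> carrier_mat n n"
    "Q \<in> carrier_mat n n" and QP: "Q * P = 1\<^sub>m n" and AB: "A = P * B * Q"
    by auto
  have AP: "A * P = P * B"
  proof -
    have "A * P = P * B * (Q * P)"
      unfolding AB using carr by (intro assoc_mult_mat) auto
    then show ?thesis using carr by (simp add: QP)
  qed
  have B00: "B $$ (0, 0) = e1"
    using arg_cong[OF diag, of "\<lambda>l. l ! 0"] carr n by (simp add: diag_mat_def del: upt_Suc)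
  have B11: "B $$ (1, 1) = e2"
    using arg_cong[OF diag, of "\<lambda>l. l ! 1"] carr n by (simp add: diag_mat_def del: upt_Suc)
  have B0: "B $$ (j, 0) = (if j = 0 then e1 else 0)" if "j < n" for j
    using upper_triangularD[OF ut, of 0 j] that carr B00 by auto
  define b where "b = B $$ (0, 1)"
  have B1: "B $$ (j, 1) = (if j = 0 then b else if j = 1 then e2 else 0)" if "j < n" for j
    using upper_triangularD[OF ut, of 1 j] that carr B11 by (auto simp: b_def)
  define p where "p i = P $$ (i, 0)" for i
  define p' where "p' i = P $$ (i, 1)" for i
  \<comment> \<open>Since \<open>B\<close> is upper triangular, the first column of \<open>P\<close>
    is an eigenvector, and the second is one up to a multiple of the first.\<close>
  have Ap: "(\<Sum>j<n. A $$ (i, j) * p j) = e1 * p i" if i: "i < n" for i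
  proof -
    have "(\<Sum>j<n. A $$ (i, j) * p j) = (A * P) $$ (i, 0)"
      using i A carr n by (simp add: scalar_prod_def atLeast0LessThan p_def)
    also have "\<dots> = (\<Sum>j<n. P $$ (i, j) * B $$ (j, 0))"
      unfolding AP using i carr n by (simp add: scalar_prod_def atLeast0LessThan)
    also have "\<dots> = (\<Sum>j<n. if j = 0 then P $$ (i, 0) * e1 else 0)"
      by (intro sum.cong) (auto simp: B0)
    finally show ?thesis using n by (simp add: p_def)
  qed
  have Ap': "(\<Sum>j<n. A $$ (i, j) * p' j) = b * p i + e2 * p' i" if i: "i < n" for i
  proof -
    have "(\<Sum>j<n. A $$ (i, j) * p' j) = (A * P) $$ (i, 1)"
      using i A carr n by (simp add: scalar_prod_def atLeast0LessThan p'_def)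
    also have "\<dots> = (\<Sum>j<n. P $$ (i, j) * B $$ (j, 1))"
      unfolding AP using i carr n by (simp add: scalar_prod_def atLeast0LessThan)
    also have "\<dots> = (\<Sum>j<n. (if j = 0 then P $$ (i, 0) * b else 0) + (if j = 1 then P $$ (i, 1) * e2 else 0))"
      by (intro sum.cong) (auto simp: B1[simplified])
    also have "\<dots> = P $$ (i, 0) * b + P $$ (i, 1) * e2"
      using n01 by (simp add: sum.distrib)
    finally show ?thesis by (simp add: p_def p'_def)
  qed
  have QP': "(\<Sum>j<n. Q $$ (i, j) * P $$ (j, k)) = (if i = k then 1 else 0)" if "i < n" "k < n" for i k
  proof -
    have "(\<Sum>j<n. Q $$ (i, j) * P $$ (j, k)) = (Q * P) $$ (i, k)"
      using that carr by (simp add: scalar_prod_def atLeast0LessThan)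
    then show ?thesis using that by (simp add: QP)
  qed
  have pnz: "\<exists>i<n. p i \<noteq> 0"
  proof (rule ccontr)
    assume "\<not> (\<exists>i<n. p i \<noteq> 0)"
    then have "(\<Sum>j<n. Q $$ (0, j) * P $$ (j, 0)) = 0"
      by (intro sum.neutral) (simp add: p_def)
    then show False using QP'[of 0 0] n01 by simp
  qed
  then have pp: "(\<Sum>i<n. p i * p i) \<noteq> 0"
    by (subst sum_nonneg_eq_0_iff) auto
  \<comment> \<open>Gram-Schmidt: \<open>w\<close> is the second column minus its projection onto
    \<open>p\<close>.\<close>
  define c where "c = (\<Sum>i<n. p i * p' i) / (\<Sum>i<n. p i * p i)"
  define w where "w i = p' i - c * p i" for i
  have pw: "(\<Sum>i<n. p i * w i) = 0"
  proof -
    have "(\<Sum>i<n. p i * w i) = (\<Sum>i<n. p i * p' i) - c * (\<Sum>i<n. p i * p i)"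
      by (simp add: w_def algebra_simps sum_subtractf sum_distrib_left)
    then show ?thesis using pp by (simp add: c_def)
  qed
  \<comment> \<open>Row 1 of \<open>Q\<close> is dual to the columns of \<open>P\<close>: it kills
    \<open>p\<close> and takes the value 1 on \<open>p'\<close>. Hence \<open>w\<close> is not
    zero.\<close>
  have "(\<Sum>j<n. Q $$ (1, j) * w j) = (\<Sum>j<n. Q $$ (1, j) * P $$ (j, 1)) - c * (\<Sum>j<n. Q $$ (1, j) * P $$ (j, 0))"
    by (simp add: w_def p_def p'_def algebra_simps sum_subtractf sum_distrib_left)
  also have "\<dots> = 1"
    unfolding QP'[OF n01(2) n01(2)] QP'[OF n01(2) n01(1)] by simp
  finally have Qw: "(\<Sum>j<n. Q $$ (1, j) * w j) = 1" .
  have wnz: "\<exists>i<n. w i \<noteq> 0"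
  proof (rule ccontr)
    assume "\<not> (\<exists>i<n. w i \<noteq> 0)"
    then have "(\<Sum>j<n. Q $$ (1, j) * w j) = 0"
      by (intro sum.neutral) simp
    then show False using Qw by simp
  qed
  \<comment> \<open>\<open>g\<close> is the component of \<open>A w\<close> along \<open>p\<close>.
    Moving \<open>A\<close> from \<open>w\<close> to \<open>p\<close> by symmetry shows that
    \<open>A w\<close> is orthogonal to \<open>p\<close>, so \<open>g = 0\<close>.\<close>
  define g where "g = b + c * e2 - c * e1"
  have Aw: "(\<Sum>j<n. A $$ (i, j) * w j) = e2 * w i + g * p i" if i: "i < n" for i
  proof -
    have "(\<Sum>j<n. A $$ (i, j) * w j) = (\<Sum>j<n. A $$ (i, j) * p' j) - c * (\<Sum>j<n. A $$ (i, j) * p j)"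
      by (simp add: w_def algebra_simps sum_subtractf sum_distrib_left)
    also have "\<dots> = e2 * w i + g * p i"
      unfolding Ap[OF i] Ap'[OF i] by (simp add: w_def g_def algebra_simps)
    finally show ?thesis .
  qed
  have "(\<Sum>i<n. p i * (\<Sum>j<n. A $$ (i, j) * w j)) = (\<Sum>i<n. \<Sum>j<n. p i * A $$ (i, j) * w j)"
    by (simp add: sum_distrib_left mult.assoc)
  also have "\<dots> = (\<Sum>j<n. \<Sum>i<n. p i * A $$ (i, j) * w j)"
    by (rule sum.swap)
  also have "\<dots> = (\<Sum>j<n. w j * (\<Sum>i<n. A $$ (j, i) * p i))"
    unfolding sum_distrib_left by (intro sum.cong refl) (simp add: sym mult_ac)
  also have "\<dots> = e1 * (\<Sum>j<n. p j * w j)"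
  proof -
    have "(\<Sum>j<n. w j * (\<Sum>i<n. A $$ (j, i) * p i)) = (\<Sum>j<n. w j * (e1 * p j))"
      by (intro sum.cong refl) (simp add: Ap)
    then show ?thesis by (simp add: sum_distrib_left mult_ac)
  qed
  finally have "(\<Sum>i<n. p i * (e2 * w i + g * p i)) = 0"
    by (simp add: Aw pw)
  moreover have "(\<Sum>i<n. p i * (e2 * w i + g * p i)) = e2 * (\<Sum>i<n. p i * w i) + g * (\<Sum>i<n. p i * p i)"
    by (simp add: algebra_simps sum.distrib sum_distrib_left)
  ultimately have "g = 0"
    using pw pp by simp
  then show thesis
    using that[of p w] Ap Aw pw pnz wnz by simp
qed

text \<open>The plane of two orthogonal eigenvectors meets the hyperplane of vectors with sum zero.\<close>

lemma real_symmetric_at_most_one_positive_root: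
  fixes A :: "real mat"
  assumes A: "A \<in> carrier_mat n n"
    and sym: "\<And>i j. i < n \<Longrightarrow> j < n \<Longrightarrow> A $$ (i, j) = A $$ (j, i)"
    and cp: "char_poly A = (\<Prod>e\<leftarrow>e1 # e2 # es. [:- e, 1:])"
    and neg: "\<And>x :: nat \<Rightarrow> real. (\<Sum>i<n. x i) = 0 \<Longrightarrow> (\<Sum>i<n. x i * (\<Sum>j<n. A $$ (i, j) * x j)) \<le> 0"
    and e1: "e1 > 0"
  shows "e2 \<le> 0"
proof (rule ccontr)
  assume "\<not> e2 \<le> 0"
  then have e2: "e2 > 0" by simp
  obtain v w where Av: "\<And>i. i < n \<Longrightarrow> (\<Sum>j<n. A $$ (i, j) * v j) = e1 * v i"
    and Aw: "\<And>i. i < n \<Longrightarrow> (\<Sum>j<n. A $$ (i, j) * w j) = e2 * w i"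
    and vw: "(\<Sum>i<n. v i * w i) = 0" and nz: "\<exists>i<n. v i \<noteq> 0" "\<exists>i<n. w i \<noteq> 0"
    using real_symmetric_orthogonal_eigenvectors[OF A sym cp] by blast
  have pos: "(\<Sum>i<n. x i * x i) > 0" if "\<exists>i<n. x i \<noteq> 0" for x :: "nat \<Rightarrow> real"
  proof -
    have "(\<Sum>i<n. x i * x i) \<noteq> 0"
      using that by (subst sum_nonneg_eq_0_iff) auto
    moreover have "(\<Sum>i<n. x i * x i) \<ge> 0"
      by (intro sum_nonneg) auto
    ultimately show ?thesis by simp
  qed
  note vv = pos[OF nz(1)] and ww = pos[OF nz(2)]
  \<comment> \<open>The quadratic form at \<open>s v + t w\<close>, when this vector lies in the
    hyperplane; the mixed term vanishes by orthogonality.\<close>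
  have form: "e1 * s\<^sup>2 * (\<Sum>i<n. v i * v i) + e2 * t\<^sup>2 * (\<Sum>i<n. w i * w i) \<le> 0"
    if "s * (\<Sum>i<n. v i) + t * (\<Sum>i<n. w i) = 0" for s t
  proof -
    have "(\<Sum>i<n. s * v i + t * w i) = 0"
      using that by (simp add: sum.distrib sum_distrib_left)
    from neg[OF this] have "(\<Sum>i<n. (s * v i + t * w i) * (\<Sum>j<n. A $$ (i, j) * (s * v j + t * w j))) \<le> 0" .
    moreover have "(\<Sum>j<n. A $$ (i, j) * (s * v j + t * w j)) = s * e1 * v i + t * e2 * w i" if "i < n" for i
    proof -
      have "(\<Sum>j<n. A $$ (i, j) * (s * v j + t * w j))
          = s * (\<Sum>j<n. A $$ (i, j) * v j) + t * (\<Sum>j<n. A $$ (i, j) * w j)"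
        by (simp add: algebra_simps sum.distrib sum_distrib_left)
      then show ?thesis using that by (simp add: Av Aw)
    qed
    moreover have "(\<Sum>i<n. (s * v i + t * w i) * (s * e1 * v i + t * e2 * w i))
        = e1 * s\<^sup>2 * (\<Sum>i<n. v i * v i) + e2 * t\<^sup>2 * (\<Sum>i<n. w i * w i)
          + s * t * (e1 + e2) * (\<Sum>i<n. v i * w i)"
      by (simp add: algebra_simps power2_eq_square sum.distrib sum_distrib_left)
    ultimately show ?thesis
      using vw by simp
  qed
  \<comment> \<open>A nontrivial combination with sum zero is \<open>v\<close> itself, or else
    \<open>v\<close> and \<open>w\<close> weighted by each other's sums with opposite signs. The
    form is positive there.\<close>
  show False
  proof (cases "(\<Sum>i<n. v i) = 0")
    case True
    then show False
      using form[of 1 0] e1 vv by (simp add: mult_le_0_iff)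
  next
    case False
    have "e1 * (\<Sum>i<n. w i)\<^sup>2 * (\<Sum>i<n. v i * v i) \<ge> 0"
      using e1 vv by simp
    moreover have "e2 * (\<Sum>i<n. v i)\<^sup>2 * (\<Sum>i<n. w i * w i) > 0"
      using e2 ww False by simp
    ultimately show False
      using form[of "\<Sum>i<n. w i" "- (\<Sum>i<n. v i)"] by (simp add: mult.commute)
  qed
qed

section \<open>Elementary symmetric functions with one negative argument\<close>

text \<open>Generating function of the elementary symmetric functions: the coefficient at
  \<open>k\<close> is \<open>E_k\<close> of the values of \<open>f\<close> on
  \<open>I\<close>.\<close>

definition esym_poly :: "('i \<Rightarrow> 'a :: comm_ring_1) \<Rightarrow> 'i set \<Rightarrow> 'a poly" where
  "esym_poly f I = (\<Prod>i\<in>I. [:1, f i:])"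

lemma esym_poly_remove:
  assumes "finite I" "i \<in> I"
  shows "esym_poly f I = esym_poly f (I - {i}) + Polynomial.smult (f i) (pCons 0 (esym_poly f (I - {i})))"
  using prod.remove[OF assms, of "\<lambda>i. [:1, f i:]"] by (simp add: esym_poly_def)

text \<open>Splits the monomials into those without and those with the factor \<open>f i\<close>.
  The shift by \<open>pCons 0\<close> stands for \<open>E_(k-1)\<close> and gives 0 at
  \<open>k = 0\<close>, which avoids a case distinction.\<close>

lemma coeff_esym_poly_remove:
  assumes "finite I" "i \<in> I"
  shows "coeff (esym_poly f I) k =
    coeff (esym_poly f (I - {i})) k + f i * coeff (pCons 0 (esym_poly f (I - {i}))) k"
  by (subst esym_poly_remove[OF assms]) (simp add: coeff_pCons split: nat.split)

text \<open>The product rule applied to the generating function; in terms of monomials, each one of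
  degree \<open>k + 1\<close> is counted once for each of its factors.\<close>

lemma coeff_esym_poly_Suc:
  fixes f :: "'i \<Rightarrow> 'a :: idom"
  assumes "finite I"
  shows "of_nat (Suc k) * coeff (esym_poly f I) (Suc k) = (\<Sum>i\<in>I. f i * coeff (esym_poly f (I - {i})) k)"
proof -
  have "of_nat (Suc k) * coeff (esym_poly f I) (Suc k) = coeff (pderiv (esym_poly f I)) k"
    by (simp only: coeff_pderiv)
  also have "pderiv (esym_poly f I) = (\<Sum>i\<in>I. esym_poly f (I - {i}) * [:f i:])"
    unfolding esym_poly_def pderiv_prod by (intro sum.cong refl) (simp add: pderiv_pCons)
  also have "coeff \<dots> k = (\<Sum>i\<in>I. f i * coeff (esym_poly f (I - {i})) k)"
    by (simp add: coeff_sum)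
  finally show ?thesis .
qed

text \<open>Each monomial of degree \<open>k\<close> survives the removal of exactly the
  \<open>card I - k\<close> indices outside it.\<close>

lemma sum_coeff_esym_poly_remove:
  fixes f :: "'i \<Rightarrow> real"
  assumes "finite I"
  shows "(\<Sum>i\<in>I. coeff (esym_poly f (I - {i})) k) = (real (card I) - real k) * coeff (esym_poly f I) k"
proof -
  have "coeff (esym_poly f I) k =
      coeff (esym_poly f (I - {i})) k + f i * coeff (pCons 0 (esym_poly f (I - {i}))) k" if "i \<in> I" for i
    using coeff_esym_poly_remove[OF assms that] .
  then have "(\<Sum>i\<in>I. coeff (esym_poly f (I - {i})) k)
      = (\<Sum>i\<in>I. coeff (esym_poly f I) k - f i * coeff (pCons 0 (esym_poly f (I - {i}))) k)"
    by (intro sum.cong refl) simp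
  also have "\<dots> = real (card I) * coeff (esym_poly f I) k
      - (\<Sum>i\<in>I. f i * coeff (pCons 0 (esym_poly f (I - {i}))) k)"
    by (simp add: sum_subtractf)
  also have "(\<Sum>i\<in>I. f i * coeff (pCons 0 (esym_poly f (I - {i}))) k) = real k * coeff (esym_poly f I) k"
    using coeff_esym_poly_Suc[OF assms, of _ f] by (cases k) auto
  finally show ?thesis by (simp add: algebra_simps)
qed

text \<open>Chebyshev's sum inequality: the coefficients of the polynomials with the factor \<open>i\<close> removed
  are oppositely ordered to the numbers \<open>f i\<close>.\<close>

lemma coeff_esym_poly_Suc_le:
  fixes f :: "'i \<Rightarrow> real"
  assumes fin: "finite I"
    and nonneg: "\<And>i j. i \<in> I \<Longrightarrow> j \<in> I \<Longrightarrow> i \<noteq> j \<Longrightarrow> coeff (pCons 0 (esym_poly f (I - {i} - {j}))) k \<ge> 0"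
  shows "real (card I) * (real (Suc k) * coeff (esym_poly f I) (Suc k))
    \<le> (\<Sum>i\<in>I. f i) * ((real (card I) - real k) * coeff (esym_poly f I) k)"
proof -
  define c where "c i = coeff (esym_poly f (I - {i})) k" for i
  \<comment> \<open>Removing both indices shows \<open>c i - c j = (f j - f i) * g\<close> with
    \<open>g\<close> nonnegative.\<close>
  have opp: "(f i - f j) * (c i - c j) \<le> 0" if ij: "i \<in> I" "j \<in> I" for i j
  proof (cases "i = j")
    case False
    define g where "g = coeff (pCons 0 (esym_poly f (I - {i} - {j}))) k"
    have "c i = coeff (esym_poly f (I - {i} - {j})) k + f j * g"
      unfolding c_def g_def using ij False fin by (intro coeff_esym_poly_remove) auto
    moreover have "c j = coeff (esym_poly f (I - {i} - {j})) k + f i * g"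
      using coeff_esym_poly_remove[of "I - {j}" i f k] ij False fin
      unfolding c_def g_def by (auto simp: Diff_insert2[symmetric] insert_commute)
    ultimately have "(f i - f j) * (c i - c j) = - ((f i - f j)\<^sup>2 * g)"
      by (simp add: power2_eq_square algebra_simps)
    also have "\<dots> \<le> 0"
      using nonneg[OF ij False] by (simp add: g_def)
    finally show ?thesis .
  qed simp
  \<comment> \<open>Summed over all ordered pairs, these products give twice the defect in
    Chebyshev's inequality.\<close>
  have "(\<Sum>i\<in>I. \<Sum>j\<in>I. (f i - f j) * (c i - c j))
      = (\<Sum>i\<in>I. \<Sum>j\<in>I. f i * c i) + (\<Sum>i\<in>I. \<Sum>j\<in>I. f j * c j)
        - (\<Sum>i\<in>I. \<Sum>j\<in>I. f i * c j) - (\<Sum>i\<in>I. \<Sum>j\<in>I. f j * c i)"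
    by (simp add: algebra_simps sum.distrib sum_subtractf)
  also have "(\<Sum>i\<in>I. \<Sum>j\<in>I. f i * c i) = real (card I) * (\<Sum>i\<in>I. f i * c i)"
    by (simp add: sum_distrib_left)
  also have "(\<Sum>i\<in>I. \<Sum>j\<in>I. f j * c j) = real (card I) * (\<Sum>i\<in>I. f i * c i)"
    by simp
  also have "(\<Sum>i\<in>I. \<Sum>j\<in>I. f i * c j) = (\<Sum>i\<in>I. f i) * (\<Sum>i\<in>I. c i)"
    by (simp add: sum_product)
  also have "(\<Sum>i\<in>I. \<Sum>j\<in>I. f j * c i) = (\<Sum>i\<in>I. f i) * (\<Sum>i\<in>I. c i)"
    by (subst sum.swap) (simp add: sum_product)
  finally have "(\<Sum>i\<in>I. \<Sum>j\<in>I. (f i - f j) * (c i - c j))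
      = 2 * (real (card I) * (\<Sum>i\<in>I. f i * c i) - (\<Sum>i\<in>I. f i) * (\<Sum>i\<in>I. c i))"
    by simp
  moreover have "(\<Sum>i\<in>I. \<Sum>j\<in>I. (f i - f j) * (c i - c j)) \<le> 0"
    by (intro sum_nonpos opp)
  moreover have "(\<Sum>i\<in>I. f i * c i) = real (Suc k) * coeff (esym_poly f I) (Suc k)"
    unfolding c_def by (rule coeff_esym_poly_Suc[OF fin, symmetric])
  moreover have "(\<Sum>i\<in>I. c i) = (real (card I) - real k) * coeff (esym_poly f I) k"
    unfolding c_def by (rule sum_coeff_esym_poly_remove[OF fin])
  ultimately show ?thesis by simp
qed

lemma coeff_esym_poly_nonneg:
  fixes f :: "'i \<Rightarrow> real"
  assumes "finite J" "\<And>i. i \<in> J \<Longrightarrow> f i > 0"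
  shows "coeff (esym_poly f J) m \<ge> 0"
  using assms
proof (induction J arbitrary: m rule: finite_induct)
  case (insert a J)
  then have "esym_poly f (insert a J) = esym_poly f J + Polynomial.smult (f a) (pCons 0 (esym_poly f J))"
    using esym_poly_remove[of "insert a J" a f] by simp
  with insert show ?case
    by (auto simp: coeff_pCons less_imp_le split: nat.split)
qed (auto simp: esym_poly_def coeff_1)

text \<open>Multiplying \<open>E_m\<close> by the sum of the inverses and cancelling produces every
  monomial of \<open>E_(m-1)\<close>, while all other terms are positive. The induction carries
  positivity along; the ratio bound later controls the one negative argument.\<close>

lemma coeff_esym_poly_pos_ratio:
  fixes f :: "'i \<Rightarrow> real"
  assumes "finite J" "\<And>i. i \<in> J \<Longrightarrow> f i > 0" "m \<le> card J"
  shows "coeff (esym_poly f J) m > 0"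
    and "coeff (pCons 0 (esym_poly f J)) m \<le> (\<Sum>i\<in>J. inverse (f i)) * coeff (esym_poly f J) m"
proof -
  have "coeff (esym_poly f J) m > 0 \<and>
      coeff (pCons 0 (esym_poly f J)) m \<le> (\<Sum>i\<in>J. inverse (f i)) * coeff (esym_poly f J) m"
    using assms
  proof (induction J arbitrary: m rule: finite_induct)
    case (insert a J)
    let ?F = "esym_poly f J"
    have F: "coeff (esym_poly f (insert a J)) k = coeff ?F k + f a * coeff (pCons 0 ?F) k" for k
      using coeff_esym_poly_remove[of "insert a J" a f k] insert by simp
    have nn: "coeff ?F q \<ge> 0" for q
      using insert by (intro coeff_esym_poly_nonneg) auto
    have fa: "f a > 0" using insert by auto
    define s where "s = (\<Sum>i\<in>J. inverse (f i))"
    have s: "s \<ge> 0" unfolding s_def using insert by (intro sum_nonneg) (auto simp: less_imp_le)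
    show ?case
    proof (cases m)
      case 0
      then show ?thesis using insert.IH[of 0] insert.prems insert.hyps fa s nn[of 0]
        by (simp add: F flip: s_def) (simp add: add_nonneg_nonneg less_imp_le)
    next
      case (Suc q)
      then have q: "coeff ?F q > 0" "coeff (pCons 0 ?F) q \<le> s * coeff ?F q"
        using insert.IH[of q] insert.prems insert.hyps by (auto simp: s_def)
      have pos: "coeff (esym_poly f (insert a J)) m > 0"
        using q fa nn[of m] by (simp add: F Suc add_nonneg_pos)
      have "coeff ?F q + f a * coeff (pCons 0 ?F) q \<le> coeff ?F q + f a * (s * coeff ?F q)"
        using q fa by simp
      also have "\<dots> \<le> (inverse (f a) + s) * (coeff ?F (Suc q) + f a * coeff ?F q)"
      proof -
        have "(inverse (f a) + s) * (coeff ?F (Suc q) + f a * coeff ?F q)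
            = coeff ?F q + f a * (s * coeff ?F q) + (inverse (f a) + s) * coeff ?F (Suc q)"
          using fa by (simp add: field_simps)
        moreover have "(inverse (f a) + s) * coeff ?F (Suc q) \<ge> 0"
          using fa s nn[of "Suc q"] by simp
        ultimately show ?thesis by linarith
      qed
      finally have "coeff (pCons 0 (esym_poly f (insert a J))) m
          \<le> (\<Sum>i\<in>insert a J. inverse (f i)) * coeff (esym_poly f (insert a J)) m"
        using insert.hyps by (simp add: F Suc s_def)
      with pos show ?thesis by blast
    qed
  qed (auto simp: esym_poly_def)
  then show "coeff (esym_poly f J) m > 0"
    and "coeff (pCons 0 (esym_poly f J)) m \<le> (\<Sum>i\<in>J. inverse (f i)) * coeff (esym_poly f J) m"
    by auto
qed

text \<open>If \<open>u\<close> lies in \<open>J\<close>, then \<open>E_m\<close> of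
  \<open>J\<close> is \<open>E_m\<close> of \<open>?K\<close> minus \<open>- f u\<close> times
  \<open>E_(m-1)\<close> of \<open>?K\<close>. By the ratio bound the second term is smaller as soon
  as the inverses over \<open>?K\<close> sum to less than \<open>- inverse (f u)\<close>.\<close>

lemma coeff_esym_poly_pos_of_negative:
  fixes f :: "'i \<Rightarrow> real"
  assumes fin: "finite I" and u: "u \<in> I" "f u < 0" and pos: "\<And>i. i \<in> I \<Longrightarrow> i \<noteq> u \<Longrightarrow> f i > 0"
    and zero: "(\<Sum>i\<in>I. inverse (f i)) = 0"
    and J: "J \<subset> I" and m: "m < card J"
  shows "coeff (esym_poly f J) m > 0"
proof (cases "u \<in> J")
  case False
  then show ?thesis
    using J m pos fin by (intro coeff_esym_poly_pos_ratio(1)) (auto dest: finite_subset)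
next
  case True
  let ?K = "J - {u}"
  have finJ: "finite J" using J fin finite_subset by auto
  have m': "m \<le> card ?K"
    using m True finJ by simp
  have posK: "f i > 0" if "i \<in> ?K" for i using that J pos by auto
  define s where "s = (\<Sum>i\<in>?K. inverse (f i))"
  \<comment> \<open>The inverses over all of \<open>I - {u}\<close> sum to exactly
    \<open>- inverse (f u)\<close>. The index \<open>a\<close> left out of \<open>J\<close>
    contributes a positive inverse, which makes the comparison strict.\<close>
  from J obtain a where a: "a \<in> I" "a \<notin> J" by auto
  have "s < s + inverse (f a)"
    using a True pos by auto
  also have "\<dots> = (\<Sum>i\<in>insert a ?K. inverse (f i))"
    using a finJ by (simp add: s_def)
  also have "\<dots> \<le> (\<Sum>i\<in>I - {u}. inverse (f i))"
    using a J fin True pos by (intro sum_mono2) (auto simp: less_imp_le)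
  also have "\<dots> = - inverse (f u)"
    using zero sum.remove[OF fin u(1), of "\<lambda>i. inverse (f i)"] by simp
  finally have s: "- f u * s < 1"
    using u by (simp add: field_simps)
  have "coeff (esym_poly f J) m = coeff (esym_poly f ?K) m - (- f u) * coeff (pCons 0 (esym_poly f ?K)) m"
    using coeff_esym_poly_remove[OF finJ True, of f m] by simp
  also have "\<dots> \<ge> coeff (esym_poly f ?K) m - (- f u) * (s * coeff (esym_poly f ?K) m)"
    using coeff_esym_poly_pos_ratio(2)[of ?K f m] finJ posK m' u
    by (simp add: s_def mult_left_mono_neg)
  moreover have "coeff (esym_poly f ?K) m - (- f u) * (s * coeff (esym_poly f ?K) m)
      = (1 - (- f u * s)) * coeff (esym_poly f ?K) m"
    by (simp add: algebra_simps)
  moreover have "\<dots> > 0"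
    using s coeff_esym_poly_pos_ratio(1)[of ?K f m] finJ posK m' by (intro mult_pos_pos) auto
  ultimately show ?thesis by linarith
qed

lemma esym_poly_one_negative:
  fixes f :: "'i \<Rightarrow> real"
  assumes fin: "finite I" and u: "u \<in> I" "f u < 0" and pos: "\<And>i. i \<in> I \<Longrightarrow> i \<noteq> u \<Longrightarrow> f i > 0"
    and zero: "(\<Sum>i\<in>I. inverse (f i)) = 0" and k: "k + 2 \<le> card I"
  shows "coeff (esym_poly f I) k > 0"
    and "real (card I) * (real (Suc k) * coeff (esym_poly f I) (Suc k))
      \<le> (\<Sum>i\<in>I. f i) * ((real (card I) - real k) * coeff (esym_poly f I) k)"
proof -
  note posJ = coeff_esym_poly_pos_of_negative[OF fin u pos zero]
  have "\<not> I \<subseteq> {u}"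
    using k card_mono[of "{u}" I] by auto
  \<comment> \<open>Removing an index \<open>a\<close> with \<open>f a > 0\<close> writes
    \<open>E_k\<close> as a positive term plus a nonnegative one.\<close>
  then obtain a where a: "a \<in> I" "a \<noteq> u" by auto
  have p: "coeff (esym_poly f (I - {a})) l > 0" if "l \<le> k" for l
    using a k that fin by (intro posJ) auto
  show "coeff (esym_poly f I) k > 0"
    using p[of k] p[of "k - 1"] pos[OF a]
    by (subst esym_poly_remove[OF fin a(1)])
      (auto simp: coeff_pCons intro!: add_pos_nonneg split: nat.split)
  show "real (card I) * (real (Suc k) * coeff (esym_poly f I) (Suc k))
      \<le> (\<Sum>i\<in>I. f i) * ((real (card I) - real k) * coeff (esym_poly f I) k)"
  proof (rule coeff_esym_poly_Suc_le[OF fin])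
    \<comment> \<open>At least \<open>k\<close> elements remain without \<open>i\<close> and
      \<open>j\<close>, and the coefficient concerned has index \<open>k - 1\<close>, so the strict
      bound on the index in \<open>posJ\<close> is met.\<close>
    fix i j assume ij: "i \<in> I" "j \<in> I" "i \<noteq> j"
    have "coeff (esym_poly f (I - {i} - {j})) l > 0" if "k = Suc l" for l
      using ij k fin that by (intro posJ) auto
    then show "coeff (pCons 0 (esym_poly f (I - {i} - {j}))) k \<ge> 0"
      by (auto simp: coeff_pCons less_imp_le split: nat.split)
  qed
qed

section \<open>Distances in trees\<close>

definition neighbours :: "'a pair_pre_digraph \<Rightarrow> 'a \<Rightarrow> 'a set" where
  "neighbours T v = {w. (v, w) \<in> parcs T}"

lemma length_rev_path [simp]: "length (rev_path p) = length p"
  by (induction p) auto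

context
  fixes T :: "'a pair_pre_digraph"
  assumes tree: "undirected_tree T"
begin

interpretation pair_graph T
  using tree by (simp add: undirected_tree_def)

lemma tree_finite_verts: "finite (pverts T)"
  by (rule pair_finite_verts)

lemma neighbours_subset: "neighbours T v \<subseteq> pverts T"
  using in_arcsD2 by (auto simp: neighbours_def)

lemma neighbours_sym: "w \<in> neighbours T v \<Longrightarrow> v \<in> neighbours T w"
  using arcs_symmetric by (auto simp: neighbours_def)

lemma neighbours_irrefl: "v \<notin> neighbours T v"
  using no_loops' by (auto simp: neighbours_def)

text \<open>Connectedness is stated for the symmetric closure, which has the same reachability as
  the symmetric graph \<open>T\<close>.\<close>

lemma ex_apath: "u \<in> pverts T \<Longrightarrow> v \<in> pverts T \<Longrightarrow> \<exists>p. apath u p v"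
proof -
  assume uv: "u \<in> pverts T" "v \<in> pverts T"
  have "strongly_connected (with_proj (mk_symmetric (with_proj T)))"
    using tree by (simp add: undirected_tree_def Digraph_Component.connected_def)
  then have "u \<rightarrow>\<^sup>*\<^bsub>with_proj (mk_symmetric (with_proj T))\<^esub> v"
    using uv by (auto simp: strongly_connected_def)
  then have "u \<rightarrow>\<^sup>*\<^bsub>with_proj T\<^esub> v"
    using reachable_mk_symmetric_eq[OF sym_arcs] by blast
  then show ?thesis by (simp add: reachable_apath)
qed

lemma ex_shortest_apath:
  assumes "u \<in> pverts T" "v \<in> pverts T"
  shows "\<exists>p. apath u p v \<and> length p = graph_dist T u v"
  unfolding graph_dist_def
  using ex_apath[OF assms] LeastI_ex[of "\<lambda>l. \<exists>p. apath u p v \<and> length p = l"] by blast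

text \<open>The minimum defining the distance runs over walks without repeated vertices only.
  Cutting the loops out of a walk does not lengthen it, so arbitrary walks may be used for upper
  bounds.\<close>

lemma graph_dist_le_length:
  assumes p: "awalk u p v"
  shows "graph_dist T u v \<le> length p"
proof -
  have q: "apath u (awalk_to_apath p) v"
    using p by (rule apath_awalk_to_apath)
  then have "graph_dist T u v \<le> length (awalk_to_apath p)"
    unfolding graph_dist_def by (intro Least_le) blast
  also have "\<dots> = card (set (awalk_to_apath p))"
    using q distinct_verts_imp_distinct by (auto simp: apath_def distinct_card)
  also have "\<dots> \<le> card (set p)"
    using awalk_to_apath_subset[OF p] by (intro card_mono) auto
  also have "\<dots> \<le> length p"
    by (rule card_length)
  finally show ?thesis .
qed

lemma graph_dist_self: "u \<in> pverts T \<Longrightarrow> graph_dist T u u = 0"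
  using graph_dist_le_length[of u "[]" u] by (simp add: awalk_Nil_iff)

lemma graph_dist_sym:
  assumes "u \<in> pverts T" "v \<in> pverts T"
  shows "graph_dist T u v = graph_dist T v u"
proof -
  have "graph_dist T x y \<le> graph_dist T y x" if xy: "x \<in> pverts T" "y \<in> pverts T" for x y
  proof -
    obtain p where "apath y p x" "length p = graph_dist T y x"
      using ex_shortest_apath[OF xy(2,1)] by blast
    then show ?thesis
      using graph_dist_le_length[of x "rev_path p" y] by (simp add: apath_def)
  qed
  then show ?thesis using assms by (simp add: antisym)
qed

lemma graph_dist_neighbour_le:
  assumes "v \<in> neighbours T u" "w \<in> pverts T"
  shows "graph_dist T u w \<le> Suc (graph_dist T v w)"
proof -
  have v: "v \<in> pverts T" "(u, v) \<in> parcs T"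
    using assms in_arcsD2 by (auto simp: neighbours_def)
  then obtain p where "apath v p w" "length p = graph_dist T v w"
    using ex_shortest_apath[OF v(1) assms(2)] by blast
  then show ?thesis
    using graph_dist_le_length[of u "(u, v) # p" w] v by (simp add: apath_def awalk_Cons_iff)
qed

lemma ex_closer_neighbour:
  assumes "u \<in> pverts T" "w \<in> pverts T" "u \<noteq> w"
  shows "\<exists>v\<in>neighbours T u. graph_dist T u w = Suc (graph_dist T v w)"
proof -
  obtain p where p: "apath u p w" "length p = graph_dist T u w"
    using ex_shortest_apath[OF assms(1,2)] by blast
  with assms(3) obtain v q where pq: "p = (u, v) # q"
    by (cases p) (auto simp: apath_def awalk_Nil_iff awalk_Cons_iff)
  then have v: "v \<in> neighbours T u" and q: "awalk v q w"
    using p by (auto simp: neighbours_def apath_def awalk_Cons_iff)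
  have "graph_dist T v w \<le> length q"
    using graph_dist_le_length[OF q] .
  then have "graph_dist T u w = Suc (graph_dist T v w)"
    using graph_dist_neighbour_le[OF v assms(2)] p pq by simp
  with v show ?thesis by blast
qed

text \<open>This is where acyclicity enters. Shortest paths from two such neighbours to
  \<open>w\<close> avoid \<open>u\<close>; joined at \<open>w\<close> and closed through
  \<open>u\<close> they would give a cycle.\<close>

lemma at_most_one_not_farther_neighbour:
  assumes w: "w \<in> pverts T" and v: "v \<in> neighbours T u" and v': "v' \<in> neighbours T u"
    and d: "graph_dist T v w \<le> graph_dist T u w" and d': "graph_dist T v' w \<le> graph_dist T u w"
  shows "v = v'"
proof (rule ccontr)
  assume ne: "v \<noteq> v'"
  have avoid: "\<exists>p. awalk x p w \<and> u \<notin> set (awalk_verts x p)"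
    if x: "x \<in> neighbours T u" and dx: "graph_dist T x w \<le> graph_dist T u w" for x
  proof -
    have xu: "x \<noteq> u" "x \<in> pverts T"
      using x neighbours_irrefl neighbours_subset by auto
    obtain p where p: "apath x p w" "length p = graph_dist T x w"
      using ex_shortest_apath[OF xu(2) w] by blast
    \<comment> \<open>A visit to \<open>u\<close> would leave a tail from \<open>u\<close> to
      \<open>w\<close> strictly shorter than \<open>graph_dist T x w\<close>, hence shorter than the
      distance from \<open>u\<close>.\<close>
    have "u \<notin> set (awalk_verts x p)"
    proof
      assume "u \<in> set (awalk_verts x p)"
      then obtain q r where qr: "p = q @ r" "awalk x q u" "awalk u r w"
        using awalk_decomp[of x p w u] p by (auto simp: apath_def)
      then have "q \<noteq> []" using xu by (auto simp: awalk_Nil_iff)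
      then have "length r < length p" using qr by (cases q) auto
      then show False
        using graph_dist_le_length[OF qr(3)] p dx by simp
    qed
    then show ?thesis using p by (auto simp: apath_def)
  qed
  obtain p where p: "awalk v p w" "u \<notin> set (awalk_verts v p)"
    using avoid[OF v d] by blast
  obtain p' where p': "awalk v' p' w" "u \<notin> set (awalk_verts v' p')"
    using avoid[OF v' d'] by blast
  define r where "r = p @ rev_path p'"
  have rp': "awalk w (rev_path p') v'"
    using p' by simp
  have r: "awalk v r v'"
    unfolding r_def using p(1) rp' by (rule awalk_appendI)
  have ur: "u \<notin> set (awalk_verts v r)"
    unfolding r_def set_awalk_verts_append[OF p(1) rp'] awalk_verts_rev_path[OF p'(1)]
    using p(2) p'(2) by simp
  \<comment> \<open>The joined walk \<open>r\<close> may repeat vertices. Its loop-free reduction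
    uses only arcs of \<open>r\<close>, so it still avoids \<open>u\<close> and can be closed to a
    cycle.\<close>
  define q where "q = awalk_to_apath r"
  have q: "apath v q v'"
    unfolding q_def using r by (rule apath_awalk_to_apath)
  have qne: "q \<noteq> []"
    using q ne by (auto simp: apath_def awalk_Nil_iff)
  have "set q \<subseteq> set r"
    unfolding q_def using r by (rule awalk_to_apath_subset)
  then have rne: "r \<noteq> []" using qne by auto
  have uq: "u \<notin> set (awalk_verts v q)"
    using ur \<open>set q \<subseteq> set r\<close> set_awalk_verts_not_Nil[OF r rne] q
      set_awalk_verts_not_Nil[of v q v'] qne by (auto simp: apath_def)
  let ?c = "(u, v) # q @ [(v', u)]"
  have arcs: "(u, v) \<in> parcs T" "(v', u) \<in> parcs T"
    using v v' neighbours_sym by (auto simp: neighbours_def)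
  have qv: "awalk v q v'" using q by (simp add: apath_def)
  have vu: "awalk v' [(v', u)] u"
    using arcs in_arcsD1[OF arcs(1)] by (simp add: awalk_simps)
  have tail: "awalk v (q @ [(v', u)]) u"
    using qv vu by (rule awalk_appendI)
  then have c: "awalk u ?c u"
    using arcs by (simp add: awalk_Cons_iff del: awalk_append_iff)
  have "awalk_verts v (q @ [(v', u)]) = awalk_verts v q @ [u]"
    using awalk_verts_append[OF tail] qv by simp
  then have "distinct (tl (awalk_verts u ?c))"
    using q uq by (simp add: apath_def)
  with c have "cycle ?c"
    unfolding cycle_def by blast
  \<comment> \<open>Since \<open>v\<close> and \<open>v'\<close> differ, \<open>q\<close> has at
    least one arc besides the two at \<open>u\<close>.\<close>
  moreover have "3 \<le> length ?c"
    using qne by (cases q) auto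
  ultimately show False
    using tree unfolding undirected_tree_def by blast
qed

text \<open>The local picture behind \<open>laplacian_dist\<close> and
  \<open>sum_degree_weighted\<close>: seen from \<open>w\<close>, a vertex has one parent, and all
  its other neighbours are children.\<close>

lemma graph_dist_neighbours:
  assumes "u \<in> pverts T" "w \<in> pverts T" "u \<noteq> w"
  obtains v where "v \<in> neighbours T u" "graph_dist T u w = Suc (graph_dist T v w)"
    "\<And>x. x \<in> neighbours T u \<Longrightarrow> x \<noteq> v \<Longrightarrow> graph_dist T x w = Suc (graph_dist T u w)"
proof -
  obtain v where v: "v \<in> neighbours T u" "graph_dist T u w = Suc (graph_dist T v w)"
    using ex_closer_neighbour[OF assms] by blast
  show thesis
  proof (rule that[OF v])
    fix x assume x: "x \<in> neighbours T u" "x \<noteq> v"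
    have "\<not> graph_dist T x w \<le> graph_dist T u w"
      using at_most_one_not_farther_neighbour[OF assms(2) v(1) x(1)] v(2) x(2) by auto
    moreover have "graph_dist T x w \<le> Suc (graph_dist T u w)"
      using graph_dist_neighbour_le[OF neighbours_sym[OF x(1)] assms(2)] .
    ultimately show "graph_dist T x w = Suc (graph_dist T u w)" by simp
  qed
qed

lemma graph_dist_neighbour:
  assumes "v \<in> neighbours T u"
  shows "graph_dist T v u = 1"
proof -
  have uv: "u \<in> pverts T" "v \<in> pverts T" "v \<noteq> u"
    using assms neighbours_subset neighbours_sym neighbours_irrefl by blast+
  have "graph_dist T v u \<le> 1"
    using graph_dist_neighbour_le[OF neighbours_sym[OF assms] uv(1)] graph_dist_self[OF uv(1)] by simp
  moreover have "graph_dist T v u \<noteq> 0"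
    using ex_closer_neighbour[OF uv(2,1,3)] by auto
  ultimately show ?thesis by simp
qed

section \<open>Counting the paths of length 2\<close>

text \<open>A copy of the path is determined by its centre \<open>v\<close>, the preimage of 1, and
  the pair \<open>N\<close> of its end points.\<close>

lemma path3_subgraphD:
  assumes sub: "subgraph (with_proj H) (with_proj T)"
    and iso: "digraph_iso (with_proj H) (with_proj path_graph3)"
  shows "\<exists>v\<in>pverts T. \<exists>N. N \<subseteq> neighbours T v \<and> card N = 2 \<and>
    H = \<lparr> pverts = insert v N, parcs = {v} \<times> N \<union> N \<times> {v} \<rparr>"
proof -
  have HT: "pverts H \<subseteq> pverts T" "parcs H \<subseteq> parcs T" and wfH: "pair_wf_digraph H"
    using sub by (auto simp: subgraph_def wf_digraph_wp_iff)
  obtain f where f: "pre_digraph.digraph_isomorphism (with_proj H) f"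
    and path: "with_proj path_graph3 = app_iso f (with_proj H)"
    using iso by (auto simp: digraph_iso_def)
  define g where "g = iso_verts f"
  have inj: "inj_on g (pverts H)"
    using f by (simp add: pre_digraph.digraph_isomorphism_def g_def)
  have verts: "g ` pverts H = {0, 1, 2}"
    using arg_cong[OF path, of verts] by (simp add: path_graph3_def g_def)
  \<comment> \<open>The image digraph has tail \<open>fst\<close> and head \<open>snd\<close>, so
    the action of \<open>f\<close> on arcs is determined by its vertex map \<open>g\<close>.\<close>
  have ends: "iso_tail f = fst" "iso_head f = snd"
    using arg_cong[OF path, of tail] arg_cong[OF path, of head] by simp_all
  have "iso_arcs f a = (g (fst a), g (snd a))" if "a \<in> parcs H" for a
    using f that by (auto simp: pre_digraph.digraph_isomorphism_def ends g_def prod_eq_iff)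
  then have "(\<lambda>a. (g (fst a), g (snd a))) ` parcs H = iso_arcs f ` parcs H"
    by (intro image_cong) auto
  also have "\<dots> = {(0, 1), (1, 0), (1, 2), (2, 1)}"
    using arg_cong[OF path, of arcs] by (simp add: path_graph3_def)
  finally have arcs: "(\<lambda>a. (g (fst a), g (snd a))) ` parcs H = {(0, 1), (1, 0), (1, 2), (2, 1)}" .
  obtain u v w where uvw: "u \<in> pverts H" "v \<in> pverts H" "w \<in> pverts H" "g u = 0" "g v = 1" "g w = 2"
    using verts by (metis (no_types, opaque_lifting) imageE insertI1 insertI2)
  then have ne: "u \<noteq> w" "u \<noteq> v" "v \<noteq> w" by auto
  have eq: "x = u" if "x \<in> pverts H" "g x = 0" for x
    using inj uvw that by (auto simp: inj_on_def)
  have eq': "x = v" if "x \<in> pverts H" "g x = 1" for x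
    using inj uvw that by (auto simp: inj_on_def)
  have eq'': "x = w" if "x \<in> pverts H" "g x = 2" for x
    using inj uvw that by (auto simp: inj_on_def)
  have pv: "pverts H = {u, v, w}"
  proof
    show "pverts H \<subseteq> {u, v, w}"
      using verts eq eq' eq'' by blast
  qed (use uvw in auto)
  have in_verts: "x \<in> pverts H" "y \<in> pverts H" if "(x, y) \<in> parcs H" for x y
    using wfH that by (auto simp: pair_wf_digraph_def)
  have pa: "parcs H = {(u, v), (v, u), (v, w), (w, v)}"
  proof
    show "parcs H \<subseteq> {(u, v), (v, u), (v, w), (w, v)}"
    proof (rule subrelI)
      fix x y assume xy: "(x, y) \<in> parcs H"
      have "(g x, g y) \<in> {(0, 1), (1, 0), (1, 2), (2, 1)}"
        unfolding arcs[symmetric] using xy by force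
      then show "(x, y) \<in> {(u, v), (v, u), (v, w), (w, v)}"
        using in_verts[OF xy] by (auto dest: eq eq' eq'')
    qed
    have *: "(x, y) \<in> parcs H"
      if xy: "x \<in> pverts H" "y \<in> pverts H" "(g x, g y) \<in> {(0, 1), (1, 0), (1, 2), (2, 1)}" for x y
    proof -
      obtain x' y' where x'y': "(x', y') \<in> parcs H" "g x = g x'" "g y = g y'"
        using xy(3) unfolding arcs[symmetric] by auto
      then have "x = x'" "y = y'"
        using in_verts[OF x'y'(1)] xy inj by (auto dest: inj_onD)
      then show ?thesis using x'y' by simp
    qed
    show "{(u, v), (v, u), (v, w), (w, v)} \<subseteq> parcs H"
      using *[of u v] *[of v u] *[of v w] *[of w v] uvw by simp
  qed
  have "H = \<lparr> pverts = insert v {u, w}, parcs = {v} \<times> {u, w} \<union> {u, w} \<times> {v} \<rparr>"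
    using pv pa by (intro pair_pre_digraph.equality) auto
  moreover have "{u, w} \<subseteq> neighbours T v" "v \<in> pverts T"
    using HT pa pv by (auto simp: neighbours_def)
  moreover have "card {u, w} = 2" using ne by simp
  ultimately show ?thesis by blast
qed

text \<open>Centres with pairs of neighbours parametrize all copies. Surjectivity gives the upper
  bound, which is the direction that turns many paths into a large sum over degrees.\<close>

lemma num_paths2_le: "num_paths2 T \<le> (\<Sum>v\<in>pverts T. card (neighbours T v) choose 2)"
proof -
  let ?P = "SIGMA v:pverts T. {N. N \<subseteq> neighbours T v \<and> card N = 2}"
  have fin: "finite (neighbours T v)" for v
    using neighbours_subset tree_finite_verts finite_subset by blast
  have "num_paths2 T \<le> card ((\<lambda>(v, N). \<lparr> pverts = insert v N, parcs = {v} \<times> N \<union> N \<times> {v} \<rparr>) ` ?P)"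
    unfolding num_paths2_def
  proof (rule card_mono)
    show "finite ((\<lambda>(v, N). \<lparr> pverts = insert v N, parcs = {v} \<times> N \<union> N \<times> {v} \<rparr>) ` ?P)"
      using fin tree_finite_verts by (intro finite_imageI finite_SigmaI) auto
  next
    show "{H. subgraph (with_proj H) (with_proj T) \<and> digraph_iso (with_proj H) (with_proj path_graph3)}
        \<subseteq> (\<lambda>(v, N). \<lparr> pverts = insert v N, parcs = {v} \<times> N \<union> N \<times> {v} \<rparr>) ` ?P"
    proof
      fix H assume "H \<in> {H. subgraph (with_proj H) (with_proj T) \<and> digraph_iso (with_proj H) (with_proj path_graph3)}"
      then obtain v N where "v \<in> pverts T" "N \<subseteq> neighbours T v" "card N = 2"
        and "H = \<lparr> pverts = insert v N, parcs = {v} \<times> N \<union> N \<times> {v} \<rparr>"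
        using path3_subgraphD[of H] by blast
      then show "H \<in> (\<lambda>(v, N). \<lparr> pverts = insert v N, parcs = {v} \<times> N \<union> N \<times> {v} \<rparr>) ` ?P"
        by (intro image_eqI[of _ _ "(v, N)"]) auto
    qed
  qed
  also have "\<dots> \<le> card ?P"
    using fin tree_finite_verts by (intro card_image_le finite_SigmaI) auto
  also have "\<dots> = (\<Sum>v\<in>pverts T. card (neighbours T v) choose 2)"
    using fin tree_finite_verts by (subst card_SigmaI) (auto simp: n_subsets)
  finally show ?thesis .
qed

end

section \<open>The inverse of the distance matrix\<close>

lemma real_choose_two: "real (k choose 2) = real k * (real k - 1) / 2"
  by (induction k) (simp_all add: numeral_2_eq_2 field_simps)

definition tau :: "'a pair_pre_digraph \<Rightarrow> 'a \<Rightarrow> real" where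
  "tau T v = 2 - real (card (neighbours T v))"

definition laplacian :: "'a pair_pre_digraph \<Rightarrow> 'a \<Rightarrow> 'a \<Rightarrow> real" where
  "laplacian T u v = (if u = v then real (card (neighbours T u)) else 0) - (if v \<in> neighbours T u then 1 else 0)"

definition distance_inverse :: "'a pair_pre_digraph \<Rightarrow> 'a \<Rightarrow> 'a \<Rightarrow> real" where
  "distance_inverse T u v =
     tau T u * tau T v / (2 * (real (card (pverts T)) - 1)) - laplacian T u v / 2"

context
  fixes T :: "'a pair_pre_digraph" and d :: "'a \<Rightarrow> 'a \<Rightarrow> real"
  assumes tree: "undirected_tree T"
  defines "d u v \<equiv> real (graph_dist T u v)"
begin

lemma finite_neighbours: "finite (neighbours T u)"
  using neighbours_subset[OF tree] tree_finite_verts[OF tree] finite_subset by blast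

text \<open>Reversal permutes the arcs of a symmetric graph.\<close>

lemma sum_neighbours_swap:
  fixes f :: "'a \<Rightarrow> 'a \<Rightarrow> real"
  shows "(\<Sum>u\<in>pverts T. \<Sum>v\<in>neighbours T u. f u v) = (\<Sum>u\<in>pverts T. \<Sum>v\<in>neighbours T u. f v u)"
proof -
  have "(\<Sum>u\<in>pverts T. \<Sum>v\<in>neighbours T u. f u v) = (\<Sum>(u, v)\<in>(SIGMA u:pverts T. neighbours T u). f u v)"
    using tree_finite_verts[OF tree] finite_neighbours by (intro sum.Sigma) auto
  also have "\<dots> = (\<Sum>(u, v)\<in>(SIGMA u:pverts T. neighbours T u). f v u)"
    by (rule sum.reindex_bij_witness[of _ prod.swap prod.swap])
      (auto dest: neighbours_sym[OF tree] subsetD[OF neighbours_subset[OF tree]])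
  also have "\<dots> = (\<Sum>u\<in>pverts T. \<Sum>v\<in>neighbours T u. f v u)"
    using tree_finite_verts[OF tree] finite_neighbours by (intro sum.Sigma[symmetric]) auto
  finally show ?thesis .
qed

lemma sum_laplacian:
  assumes u: "u \<in> pverts T"
  shows "(\<Sum>v\<in>pverts T. laplacian T u v * f v) = real (card (neighbours T u)) * f u - (\<Sum>v\<in>neighbours T u. f v)"
proof -
  have "(\<Sum>v\<in>pverts T. laplacian T u v * f v)
      = (\<Sum>v\<in>pverts T. (if u = v then real (card (neighbours T u)) * f v else 0) - (if v \<in> neighbours T u then f v else 0))"
    by (intro sum.cong refl) (simp add: laplacian_def algebra_simps)
  also have "\<dots> = real (card (neighbours T u)) * f u - (\<Sum>v\<in>pverts T. if v \<in> neighbours T u then f v else 0)"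
    using u tree_finite_verts[OF tree] by (simp add: sum_subtractf)
  also have "(\<Sum>v\<in>pverts T. if v \<in> neighbours T u then f v else 0) = (\<Sum>v\<in>neighbours T u. f v)"
    using neighbours_subset[OF tree, of u] tree_finite_verts[OF tree]
    by (simp add: sum.inter_restrict[symmetric] Int_absorb1)
  finally show ?thesis .
qed

text \<open>For \<open>u\<close> different from \<open>w\<close>, the parent contributes -1 and
  every other neighbour +1 to the change in distance, whence \<open>2 - deg u\<close>. At
  \<open>u = w\<close> all neighbours are at distance 1 and the value is
  \<open>- deg u\<close>.\<close>

lemma laplacian_dist:
  assumes u: "u \<in> pverts T" and w: "w \<in> pverts T"
  shows "(\<Sum>v\<in>pverts T. laplacian T u v * d v w) = tau T u - (if u = w then 2 else 0)"
proof -
  have "(\<Sum>v\<in>neighbours T u. d v w)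
      = real (card (neighbours T u)) * d u w + real (card (neighbours T u)) - (if u = w then 0 else 2)"
  proof (cases "u = w")
    case True
    then show ?thesis
      using graph_dist_self[OF tree w] graph_dist_neighbour[OF tree, of _ w] by (simp add: d_def)
  next
    case False
    obtain v where v: "v \<in> neighbours T u" "graph_dist T u w = Suc (graph_dist T v w)"
      "\<And>x. x \<in> neighbours T u \<Longrightarrow> x \<noteq> v \<Longrightarrow> graph_dist T x w = Suc (graph_dist T u w)"
      using graph_dist_neighbours[OF tree u w False] by blast
    have "(\<Sum>x\<in>neighbours T u. d x w) = (\<Sum>x\<in>neighbours T u. d u w + 1 - (if x = v then 2 else 0))"
      using v by (intro sum.cong refl) (auto simp: d_def)
    then show ?thesis
      using v(1) finite_neighbours[of u] False by (simp add: sum.distrib sum_subtractf algebra_simps)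
  qed
  then show ?thesis
    unfolding sum_laplacian[OF u] by (simp add: tau_def)
qed

text \<open>Every edge is charged to its endpoint farther from the root \<open>w\<close>; each vertex other than
  \<open>w\<close> is charged exactly once.\<close>

lemma sum_degree_weighted:
  fixes f :: "'a \<Rightarrow> real"
  assumes w: "w \<in> pverts T"
    and c: "\<And>u v. u \<in> pverts T \<Longrightarrow> v \<in> neighbours T u \<Longrightarrow> d v w < d u w \<Longrightarrow> f u + f v = g u"
  shows "(\<Sum>u\<in>pverts T. real (card (neighbours T u)) * f u) = (\<Sum>u\<in>pverts T - {w}. g u)"
proof -
  \<comment> \<open>\<open>h u v\<close> is 1 exactly when the edge is charged to \<open>u\<close>.
    By \<open>h1\<close> each edge is charged to one end, by \<open>h2\<close> each vertex but
    \<open>w\<close> receives one charge.\<close>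
  define h where "h u v = (if d v w < d u w then 1 else 0 :: real)" for u v
  have h1: "h u v + h v u = 1" if u: "u \<in> pverts T" and uv: "v \<in> neighbours T u" for u v
  proof -
    have "graph_dist T u w \<noteq> graph_dist T v w"
    proof (cases "u = w")
      case True
      then show ?thesis
        using graph_dist_self[OF tree w] graph_dist_neighbour[OF tree, of v w] uv by simp
    next
      case False
      then show ?thesis
        using graph_dist_neighbours[OF tree u w False] uv by (metis n_not_Suc_n)
    qed
    then show ?thesis by (auto simp: h_def d_def)
  qed
  have h2: "(\<Sum>v\<in>neighbours T u. h u v) = (if u = w then 0 else 1)" if u: "u \<in> pverts T" for u
  proof (cases "u = w")
    case True
    then show ?thesis
      using graph_dist_self[OF tree w] by (simp add: h_def d_def)
  next
    case False
    obtain v where v: "v \<in> neighbours T u" "graph_dist T u w = Suc (graph_dist T v w)"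
      "\<And>x. x \<in> neighbours T u \<Longrightarrow> x \<noteq> v \<Longrightarrow> graph_dist T x w = Suc (graph_dist T u w)"
      using graph_dist_neighbours[OF tree u w False] by blast
    have "(\<Sum>x\<in>neighbours T u. h u x) = (\<Sum>x\<in>neighbours T u. if x = v then 1 else 0)"
      using v by (intro sum.cong refl) (auto simp: h_def d_def)
    then show ?thesis using v(1) finite_neighbours[of u] False by simp
  qed
  \<comment> \<open>Every incidence is split by which end is charged; swapping the second part
    collects \<open>f u + f v\<close> at the charged end.\<close>
  have "(\<Sum>u\<in>pverts T. real (card (neighbours T u)) * f u)
      = (\<Sum>u\<in>pverts T. \<Sum>v\<in>neighbours T u. h u v * f u + h v u * f u)"
    by (intro sum.cong refl) (simp add: h1 flip: distrib_right)
  also have "\<dots> = (\<Sum>u\<in>pverts T. \<Sum>v\<in>neighbours T u. h u v * f u) + (\<Sum>u\<in>pverts T. \<Sum>v\<in>neighbours T u. h v u * f u)"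
    by (simp add: sum.distrib)
  also have "(\<Sum>u\<in>pverts T. \<Sum>v\<in>neighbours T u. h v u * f u) = (\<Sum>u\<in>pverts T. \<Sum>v\<in>neighbours T u. h u v * f v)"
    by (rule sum_neighbours_swap)
  also have "(\<Sum>u\<in>pverts T. \<Sum>v\<in>neighbours T u. h u v * f u) + (\<Sum>u\<in>pverts T. \<Sum>v\<in>neighbours T u. h u v * f v)
      = (\<Sum>u\<in>pverts T. \<Sum>v\<in>neighbours T u. h u v * g u)"
    unfolding sum.distrib[symmetric]
    by (intro sum.cong refl) (auto simp: h_def c)
  also have "\<dots> = (\<Sum>u\<in>pverts T. if u = w then 0 else g u)"
    by (intro sum.cong refl) (simp add: h2 flip: sum_distrib_right)
  also have "\<dots> = (\<Sum>u\<in>pverts T - {w}. g u)"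
    using tree_finite_verts[OF tree] by (intro sum.mono_neutral_cong_right) auto
  finally show ?thesis .
qed

lemma sum_degrees:
  assumes "pverts T \<noteq> {}"
  shows "(\<Sum>u\<in>pverts T. real (card (neighbours T u))) = 2 * (real (card (pverts T)) - 1)"
proof -
  obtain w where w: "w \<in> pverts T" using assms by blast
  then have "card (pverts T) \<ge> 1"
    using tree_finite_verts[OF tree] by (metis One_nat_def Suc_leI card_gt_0_iff empty_iff)
  then show ?thesis
    \<comment> \<open>Constant weight 1 counts each of the \<open>n - 1\<close> edges twice.\<close>
    using sum_degree_weighted[OF w, of "\<lambda>_. 1" "\<lambda>_. 2"] w tree_finite_verts[OF tree]
    by (simp add: of_nat_diff)
qed

text \<open>Weighting by the distance, an edge charged to \<open>u\<close> joins distances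
  \<open>d u w\<close> and \<open>d u w - 1\<close>. The doubled distance sum cancels against the 2
  in \<open>tau\<close>, leaving the number of edges.\<close>

lemma sum_tau_dist:
  assumes w: "w \<in> pverts T"
  shows "(\<Sum>u\<in>pverts T. tau T u * d u w) = real (card (pverts T)) - 1"
proof -
  have card: "card (pverts T) \<ge> 1"
    using w tree_finite_verts[OF tree] by (metis One_nat_def Suc_leI card_gt_0_iff empty_iff)
  have "(\<Sum>u\<in>pverts T. real (card (neighbours T u)) * d u w) = (\<Sum>u\<in>pverts T - {w}. 2 * d u w - 1)"
  proof (rule sum_degree_weighted[OF w])
    fix u v assume u: "u \<in> pverts T" and v: "v \<in> neighbours T u" "d v w < d u w"
    have "graph_dist T u w \<le> Suc (graph_dist T v w)"
      using graph_dist_neighbour_le[OF tree v(1) w] .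
    then show "d u w + d v w = 2 * d u w - 1"
      using v(2) by (simp add: d_def)
  qed
  also have "\<dots> = 2 * (\<Sum>u\<in>pverts T - {w}. d u w) - (real (card (pverts T)) - 1)"
    using w tree_finite_verts[OF tree] card by (simp add: sum_subtractf sum_distrib_left of_nat_diff)
  also have "(\<Sum>u\<in>pverts T - {w}. d u w) = (\<Sum>u\<in>pverts T. d u w)"
    using sum.remove[OF tree_finite_verts[OF tree] w, of "\<lambda>u. d u w"] graph_dist_self[OF tree w]
    by (simp add: d_def)
  finally show ?thesis
    by (simp add: tau_def left_diff_distrib sum_subtractf sum_distrib_left)
qed

text \<open>The rank-one part yields \<open>tau T u / 2\<close>, which cancels the same term from
  \<open>laplacian_dist\<close> and leaves the identity.\<close>

lemma distance_inverse:
  assumes u: "u \<in> pverts T" and w: "w \<in> pverts T" and n: "card (pverts T) \<ge> 2"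
  shows "(\<Sum>v\<in>pverts T. distance_inverse T u v * d v w) = (if u = w then 1 else 0)"
proof -
  let ?m = "real (card (pverts T)) - 1"
  have "(\<Sum>v\<in>pverts T. distance_inverse T u v * d v w)
      = tau T u / (2 * ?m) * (\<Sum>v\<in>pverts T. tau T v * d v w) - (\<Sum>v\<in>pverts T. laplacian T u v * d v w) / 2"
    unfolding sum_distrib_left sum_divide_distrib sum_subtractf[symmetric]
    by (intro sum.cong refl) (simp add: distance_inverse_def field_simps)
  also have "tau T u / (2 * ?m) * (\<Sum>v\<in>pverts T. tau T v * d v w) = tau T u / 2"
  proof -
    have "?m \<noteq> 0" using n by simp
    then show ?thesis unfolding sum_tau_dist[OF w] by (simp del: right_diff_distrib_numeral)
  qed
  finally show ?thesis
    unfolding laplacian_dist[OF u w] by (simp add: diff_divide_distrib split: if_splits)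
qed

text \<open>For \<open>y = D x\<close> with \<open>x\<close> of sum zero, the rank-one term in
  \<open>L D\<close> vanishes and \<open>L y = -2 x\<close>. So -2 times the form is the Laplacian
  form at \<open>y\<close>.\<close>

lemma distance_form_nonpos:
  fixes x :: "'a \<Rightarrow> real"
  assumes x: "(\<Sum>u\<in>pverts T. x u) = 0"
  shows "(\<Sum>u\<in>pverts T. x u * (\<Sum>w\<in>pverts T. d u w * x w)) \<le> 0"
proof -
  define y where "y u = (\<Sum>w\<in>pverts T. d u w * x w)" for u
  have Ly: "(\<Sum>v\<in>pverts T. laplacian T u v * y v) = - 2 * x u" if u: "u \<in> pverts T" for u
  proof -
    have "(\<Sum>v\<in>pverts T. laplacian T u v * y v) = (\<Sum>w\<in>pverts T. (\<Sum>v\<in>pverts T. laplacian T u v * d v w) * x w)"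
      unfolding y_def sum_distrib_left sum_distrib_right
      by (subst sum.swap) (simp add: mult.assoc)
    also have "\<dots> = (\<Sum>w\<in>pverts T. tau T u * x w - (if u = w then 2 * x w else 0))"
      using u by (intro sum.cong refl) (auto simp: laplacian_dist left_diff_distrib)
    also have "\<dots> = - 2 * x u"
      using u x tree_finite_verts[OF tree] by (simp add: sum_subtractf flip: sum_distrib_left)
    finally show ?thesis .
  qed
  have "- 2 * (\<Sum>u\<in>pverts T. x u * y u) = (\<Sum>u\<in>pverts T. y u * (\<Sum>v\<in>pverts T. laplacian T u v * y v))"
  proof -
    have "(\<Sum>u\<in>pverts T. y u * (\<Sum>v\<in>pverts T. laplacian T u v * y v)) = (\<Sum>u\<in>pverts T. y u * (- 2 * x u))"
      by (intro sum.cong refl) (simp only: Ly)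
    then show ?thesis by (simp add: sum_distrib_left mult_ac)
  qed
  also have "\<dots> = (\<Sum>u\<in>pverts T. \<Sum>v\<in>neighbours T u. y u * (y u - y v))"
    by (intro sum.cong refl) (simp add: sum_laplacian right_diff_distrib sum_subtractf sum_distrib_left)
  finally have 1: "- 2 * (\<Sum>u\<in>pverts T. x u * y u) = (\<Sum>u\<in>pverts T. \<Sum>v\<in>neighbours T u. y u * (y u - y v))" .
  \<comment> \<open>Adding the sum to its arc-reversed copy turns it into a sum of squares over
    arcs.\<close>
  have "\<dots> + \<dots> = (\<Sum>u\<in>pverts T. \<Sum>v\<in>neighbours T u. y u * (y u - y v))
      + (\<Sum>u\<in>pverts T. \<Sum>v\<in>neighbours T u. y v * (y v - y u))"
    by (subst (2) sum_neighbours_swap) simp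
  also have "\<dots> = (\<Sum>u\<in>pverts T. \<Sum>v\<in>neighbours T u. (y u - y v)\<^sup>2)"
    unfolding sum.distrib[symmetric] by (intro sum.cong refl) (simp add: power2_eq_square algebra_simps)
  also have "\<dots> \<ge> 0"
    by (intro sum_nonneg) auto
  finally show ?thesis
    using 1 by (simp add: y_def)
qed

text \<open>The diagonal entries involve only degrees and their squares; the degree sum is known,
  and the squares are expressed through the binomial coefficients.\<close>

lemma sum_distance_inverse_diagonal:
  assumes n: "card (pverts T) = n" "n \<ge> 2"
  shows "- (real n - 1) * (\<Sum>u\<in>pverts T. distance_inverse T u u)
    = real n * (real n - 1) - 2 - (\<Sum>u\<in>pverts T. real (card (neighbours T u) choose 2))"
proof -
  define g where "g u = real (card (neighbours T u))" for u
  have "pverts T \<noteq> {}" using n by auto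
  from sum_degrees[OF this] have g: "(\<Sum>u\<in>pverts T. g u) = 2 * (real n - 1)"
    by (simp add: g_def n)
  define s where "s = (\<Sum>u\<in>pverts T. g u ^ 2)"
  have "(\<Sum>u\<in>pverts T. real (card (neighbours T u) choose 2)) = (\<Sum>u\<in>pverts T. (g u ^ 2 - g u) / 2)"
    by (intro sum.cong refl) (simp add: real_choose_two g_def power2_eq_square algebra_simps)
  also have "\<dots> = (s - 2 * (real n - 1)) / 2"
    by (simp add: s_def sum_subtractf g flip: sum_divide_distrib)
  finally have S: "(\<Sum>u\<in>pverts T. real (card (neighbours T u) choose 2)) = (s - 2 * (real n - 1)) / 2" .
  have "(real n - 1) * (\<Sum>u\<in>pverts T. distance_inverse T u u)
      = (\<Sum>u\<in>pverts T. (4 - 4 * g u + g u ^ 2) / 2 - (real n - 1) / 2 * g u)"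
    unfolding sum_distrib_left using n neighbours_irrefl[OF tree]
    by (intro sum.cong refl)
      (simp add: distance_inverse_def laplacian_def tau_def g_def power2_eq_square field_simps)
  also have "\<dots> = (4 * real n - 8 * (real n - 1) + s) / 2 - (real n - 1) * (real n - 1)"
    by (simp add: sum_subtractf sum.distrib s_def g n flip: sum_divide_distrib sum_distrib_left)
  finally show ?thesis
    unfolding S by (simp add: field_simps)
qed

text \<open>One factor of \<open>g u * (g u - 1)\<close> is bounded by \<open>n - 1\<close>, and the
  numbers \<open>g u - 1\<close> sum to \<open>n - 2\<close>. This later forces
  \<open>\<rho> \<le> 1\<close>.\<close>

lemma sum_degree_choose_two_le:
  assumes n: "card (pverts T) = n" "n \<ge> 2"
  shows "(\<Sum>u\<in>pverts T. real (card (neighbours T u) choose 2)) \<le> real ((n - 1) choose 2)"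
proof -
  define g where "g u = real (card (neighbours T u))" for u
  have "pverts T \<noteq> {}" using n by auto
  from sum_degrees[OF this] have g: "(\<Sum>u\<in>pverts T. g u) = 2 * (real n - 1)"
    by (simp add: g_def n)
  have "(\<Sum>u\<in>pverts T. real (card (neighbours T u) choose 2)) \<le> (\<Sum>u\<in>pverts T. (real n - 1) / 2 * (g u - 1))"
  proof (intro sum_mono)
    fix u assume u: "u \<in> pverts T"
    have "neighbours T u \<subseteq> pverts T - {u}"
      using neighbours_subset[OF tree] neighbours_irrefl[OF tree] by blast
    then have "card (neighbours T u) \<le> card (pverts T - {u})"
      using tree_finite_verts[OF tree] by (intro card_mono) auto
    then have "g u \<le> real n - 1"
      using u n by (simp add: g_def)
    moreover have "g u \<ge> 1"
    proof -
      have "\<exists>w\<in>pverts T. w \<noteq> u"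
        using n u by (metis card_le_Suc0_iff_eq tree_finite_verts[OF tree] not_less_eq_eq numeral_2_eq_2)
      then obtain w where "w \<in> pverts T" "u \<noteq> w" by auto
      then have "neighbours T u \<noteq> {}"
        using ex_closer_neighbour[OF tree u] by blast
      then show ?thesis
        using finite_neighbours by (simp add: g_def Suc_le_eq card_gt_0_iff)
    qed
    ultimately have "g u * (g u - 1) \<le> (real n - 1) * (g u - 1)"
      by (intro mult_right_mono) auto
    then show "real (card (neighbours T u) choose 2) \<le> (real n - 1) / 2 * (g u - 1)"
      by (simp add: real_choose_two g_def)
  qed
  also have "\<dots> = (real n - 1) / 2 * (real n - 2)"
    unfolding sum_distrib_left[symmetric] sum_subtractf g by (simp add: n)
  also have "\<dots> = real ((n - 1) choose 2)"
    using n by (simp add: real_choose_two of_nat_diff)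
  finally show ?thesis .
qed

end

section \<open>Peak location\<close>

text \<open>Each factor \<open>x - e\<close> equals \<open>- e\<close> times
  \<open>1 - x / e\<close>, so the coefficients become elementary symmetric functions of negated
  reciprocals.\<close>

lemma prod_linear_eq_esym_poly:
  fixes es :: "real list"
  assumes "0 \<notin> set es"
  shows "(\<Prod>e\<leftarrow>es. [:- e, 1:]) =
    Polynomial.smult (\<Prod>e\<leftarrow>es. - e) (esym_poly (\<lambda>i. - inverse (es ! i)) {..<length es})"
proof -
  have "(\<Prod>e\<leftarrow>es. [:- e, 1:]) = Polynomial.smult (\<Prod>e\<leftarrow>es. - e) (\<Prod>e\<leftarrow>es. [:1, - inverse e:])"
    using assms
  proof (induction es)
    case (Cons e es)
    then have "[:- e, 1:] = Polynomial.smult (- e) [:1, - inverse e:]"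
      by simp
    moreover have "(\<Prod>e\<leftarrow>es. [:- e, 1:]) = Polynomial.smult (\<Prod>e\<leftarrow>es. - e) (\<Prod>e\<leftarrow>es. [:1, - inverse e:])"
      using Cons by simp
    ultimately show ?case
      by (simp only: list.map prod_list.Cons mult_smult_left mult_smult_right smult_smult mult.commute)
  qed simp
  also have "(\<Prod>e\<leftarrow>es. [:1, - inverse e:]) = esym_poly (\<lambda>i. - inverse (es ! i)) {..<length es}"
    by (simp add: esym_poly_def prod.list_conv_set_nth atLeast0LessThan)
  finally show ?thesis .
qed

text \<open>Here \<open>x\<close> is an index at or beyond the claimed bound; the inequality says
  that there the estimate for \<open>2 * E_(x+1) / E_x\<close> is below 1.\<close>

lemma peak_index_arithmetic:
  fixes n r x :: real
  assumes n: "n \<ge> 3" and r: "0 \<le> r" "r \<le> 1"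
    and x: "(2 - r) / (3 - r) * n \<le> x" "x \<le> n"
  shows "2 * (n * (n - 1) - 2 - r * ((n - 1) * (n - 2) / 2)) * (n - x) < (n - 1) * n * (x + 1)"
proof -
  have x1: "(2 - r) * n \<le> (3 - r) * x"
    using x r by (simp add: field_simps)
  have A: "2 * (n * (n - 1) - 2 - r * ((n - 1) * (n - 2) / 2)) = (n - 1) * ((2 - r) * n + 2 * r) - 4"
    by (simp add: field_simps)
  \<comment> \<open>The main term, where the quotient \<open>(2 - r) / (3 - r)\<close> comes from;
    the lower-order term \<open>2 * r\<close> is absorbed by the 1 in \<open>x + 1\<close>.\<close>
  have "(2 - r) * n * (n - x) \<le> n * x"
  proof -
    have "n * ((2 - r) * n) \<le> n * ((3 - r) * x)"
      using x1 n by (intro mult_left_mono) auto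
    then show ?thesis by (simp add: algebra_simps)
  qed
  moreover have "2 * r * (n - x) \<le> n"
  proof -
    have "(3 - r) * (2 * r * (n - x)) \<le> (3 - r) * n"
    proof -
      have "(3 - r) * (n - x) \<le> n"
        using x1 by (simp add: algebra_simps)
      then have "2 * r * ((3 - r) * (n - x)) \<le> 2 * r * n"
        using r by (intro mult_left_mono) auto
      also have "\<dots> \<le> (3 - r) * n"
        using r n by (intro mult_right_mono) auto
      finally show ?thesis by (simp only: mult_ac)
    qed
    then show ?thesis using r by (elim mult_left_le_imp_le) auto
  qed
  ultimately have "((2 - r) * n + 2 * r) * (n - x) \<le> n * (x + 1)"
    by (simp add: algebra_simps)
  then have B: "(n - 1) * (((2 - r) * n + 2 * r) * (n - x)) \<le> (n - 1) * (n * (x + 1))"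
    using n by (intro mult_left_mono) auto
  show ?thesis
  \<comment> \<open>Strictness comes from the summand -4, multiplied by \<open>n - x\<close>; at
    \<open>x = n\<close> the left side is zero.\<close>
  proof (cases "x = n")
    case True
    have "0 < (n - 1) * n * (n + 1)"
      using n by (intro mult_pos_pos) auto
    then show ?thesis unfolding True by (simp only: diff_self mult_zero_right)
  next
    case False
    then have "4 * (n - x) > 0" using x by simp
    then show ?thesis using B unfolding A by (simp add: left_diff_distrib mult.assoc)
  qed
qed

section \<open>Spectrum and characteristic coefficients of the distance matrix\<close>

context
  fixes T :: "'a pair_pre_digraph" and vs :: "'a list" and n :: nat
  assumes tree: "undirected_tree T"
    and vs: "distinct vs" "set vs = pverts T"
    and n: "card (pverts T) = n" "n \<ge> 2"
begin

lemma length_vertices: "length vs = n"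
  using vs n distinct_card by fastforce

lemma nth_vertices: "i < n \<Longrightarrow> vs ! i \<in> pverts T"
  using vs length_vertices nth_mem by blast

lemma sum_vertices: "(\<Sum>i<n. f (vs ! i)) = (\<Sum>v\<in>pverts T. f v)"
  using sum.reindex_bij_betw[OF bij_betw_nth[OF vs(1) refl vs(2)[symmetric]], of f]
  by (simp add: length_vertices)

lemma distance_matrix_carrier: "distance_matrix T vs \<in> carrier_mat n n"
  by (simp add: distance_matrix_def length_vertices)

lemma distance_matrix_index:
  "i < n \<Longrightarrow> j < n \<Longrightarrow> distance_matrix T vs $$ (i, j) = real (graph_dist T (vs ! i) (vs ! j))"
  by (simp add: distance_matrix_def length_vertices)

lemma distance_matrix_sym:
  "i < n \<Longrightarrow> j < n \<Longrightarrow> distance_matrix T vs $$ (i, j) = distance_matrix T vs $$ (j, i)"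
  by (simp add: distance_matrix_index graph_dist_sym[OF tree] nth_vertices)

lemma distance_poly_char_poly:
  "distance_poly T vs = Polynomial.smult ((- 1) ^ n) (char_poly (distance_matrix T vs))"
proof -
  let ?D = "distance_matrix T vs"
  have "map_mat (\<lambda>a. [:a:]) ?D - [:0, 1:] \<cdot>\<^sub>m 1\<^sub>m (length vs) = (- 1) \<cdot>\<^sub>m char_poly_matrix ?D"
    using distance_matrix_carrier
    by (intro eq_matI) (auto simp: char_poly_matrix_def length_vertices)
  then have "distance_poly T vs = (- 1) ^ n * char_poly ?D"
    using distance_matrix_carrier by (simp add: distance_poly_def char_poly_def char_poly_matrix_def)
  also have "(- 1 :: real poly) ^ n = [:(- 1) ^ n:]"
    by (induction n) (auto simp: one_pCons)
  finally show ?thesis by simp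
qed

lemma distance_inverse_mat:
  "mat n n (\<lambda>(i, j). distance_inverse T (vs ! i) (vs ! j)) * distance_matrix T vs = 1\<^sub>m n"
proof (intro eq_matI)
  fix i j assume ij: "i < dim_row (1\<^sub>m n :: real mat)" "j < dim_col (1\<^sub>m n :: real mat)"
  have "(mat n n (\<lambda>(i, j). distance_inverse T (vs ! i) (vs ! j)) * distance_matrix T vs) $$ (i, j)
      = (\<Sum>k<n. distance_inverse T (vs ! i) (vs ! k) * real (graph_dist T (vs ! k) (vs ! j)))"
    using ij distance_matrix_carrier by (simp add: scalar_prod_def atLeast0LessThan distance_matrix_index)
  also have "\<dots> = (\<Sum>v\<in>pverts T. distance_inverse T (vs ! i) v * real (graph_dist T v (vs ! j)))"
    by (rule sum_vertices)
  also have "\<dots> = (if vs ! i = vs ! j then 1 else 0)"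
    using ij n by (intro distance_inverse[OF tree]) (auto simp: nth_vertices)
  also have "\<dots> = 1\<^sub>m n $$ (i, j)"
    using ij vs by (simp add: nth_eq_iff_index_eq length_vertices)
  finally show "(mat n n (\<lambda>(i, j). distance_inverse T (vs ! i) (vs ! j)) * distance_matrix T vs) $$ (i, j)
      = 1\<^sub>m n $$ (i, j)" .
qed (use distance_matrix_carrier in auto)

text \<open>Trace zero and invertibility give a positive root \<open>e\<close>, the hyperplane
  argument makes all others negative, and the reciprocals sum to the trace of the inverse.\<close>

lemma distance_matrix_spectrum:
  obtains e es where
    "char_poly (distance_matrix T vs) = (\<Prod>x\<leftarrow>e # es. [:- x, 1:])"
    "length (e # es) = n" "e > 0" "\<And>x. x \<in> set es \<Longrightarrow> x < 0" "sum_list (e # es) = 0"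
    "(real n - 1) * (\<Sum>x\<leftarrow>e # es. - inverse x)
      = real n * (real n - 1) - 2 - (\<Sum>u\<in>pverts T. real (card (neighbours T u) choose 2))"
proof -
  let ?D = "distance_matrix T vs"
  let ?R = "mat n n (\<lambda>(i, j). distance_inverse T (vs ! i) (vs ! j))"
  note D = distance_matrix_carrier
  have R: "?R \<in> carrier_mat n n" by simp
  obtain xs where xs: "char_poly ?D = (\<Prod>x\<leftarrow>xs. [:- x, 1:])"
    using real_symmetric_char_poly_factorized[OF D distance_matrix_sym] by blast
  have nz: "0 \<notin> set xs" and inv: "char_poly ?R = (\<Prod>x\<leftarrow>xs. [:- inverse x, 1:])"
    using char_poly_left_inverse[OF D R distance_inverse_mat xs] by auto
  have len: "length xs = n"
    using char_poly_roots_length[OF D xs] .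
  have sum0: "sum_list xs = 0"
    using mat_trace_eq_sum_roots[OF D xs] D
    by (simp add: mat_trace_def distance_matrix_index graph_dist_self[OF tree] nth_vertices)
  have "\<exists>e\<in>set xs. e > 0"
  proof (rule ccontr)
    assume "\<not> (\<exists>e\<in>set xs. e > 0)"
    then have "\<forall>e\<in>set xs. - e \<ge> 0" by force
    moreover have "sum_list (map uminus xs) = 0"
      using sum0 by (simp add: uminus_sum_list_map[of id, simplified, symmetric])
    ultimately have "\<forall>e\<in>set (map uminus xs). e = 0"
      by (subst sum_list_nonneg_eq_0_iff[symmetric]) auto
    moreover have "hd xs \<in> set xs" using len n by (intro hd_in_set) auto
    ultimately show False using nz by auto
  qed
  then obtain e where e: "e \<in> set xs" "e > 0" by blast
  define es where "es = remove1 e xs"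
  have mset: "mset (e # es) = mset xs"
    using e(1) by (simp add: es_def)
  have prod_eq: "(\<Prod>x\<leftarrow>e # ys. g x) = (\<Prod>x\<leftarrow>xs. g x)" if "mset (e # ys) = mset xs" for ys and g :: "real \<Rightarrow> real poly"
    using that by (metis mset_map prod_mset_prod_list)
  have sum_eq: "(\<Sum>x\<leftarrow>e # es. g x) = (\<Sum>x\<leftarrow>xs. g x)" for g :: "real \<Rightarrow> real"
    using mset by (metis mset_map sum_mset_sum_list)
  have set_es: "set es \<subseteq> set xs"
    unfolding es_def by (rule set_remove1_subset)
  show thesis
  proof (rule that)
    show "char_poly ?D = (\<Prod>x\<leftarrow>e # es. [:- x, 1:])"
      unfolding prod_eq[OF mset] by (rule xs)
    show "length (e # es) = n"
      using mset len by (metis mset_eq_length)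
    show "e > 0" by fact
    show "sum_list (e # es) = 0"
      using sum_eq[of id] sum0 by simp
  next
    fix x assume x: "x \<in> set es"
    \<comment> \<open>The two-root lemma inspects the head of the list, so \<open>x\<close> is moved
      behind \<open>e\<close>. Occurrences are removed one at a time, so a repeated root
      \<open>x = e\<close> is covered.\<close>
    have "mset (e # x # remove1 x es) = mset xs"
      using x mset by simp
    then have "char_poly ?D = (\<Prod>y\<leftarrow>e # x # remove1 x es. [:- y, 1:])"
      unfolding xs by (rule prod_eq[symmetric])
    moreover have "(\<Sum>i<n. f i * (\<Sum>j<n. ?D $$ (i, j) * f j)) \<le> 0"
      if f: "(\<Sum>i<n. f i) = 0" for f
    proof -
      \<comment> \<open>\<open>h\<close> carries the index vector over to the vertices.\<close>
      define h where "h v = f (inv_into {..<n} ((!) vs) v)" for v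
      have h: "h (vs ! i) = f i" if "i < n" for i
        using that inv_into_f_f[OF inj_on_nth[OF vs(1)], of "{..<n}" i] length_vertices
        by (simp add: h_def)
      have "(\<Sum>u\<in>pverts T. h u) = 0"
        using f h by (simp flip: sum_vertices)
      from distance_form_nonpos[OF tree this]
      show ?thesis
        by (simp add: h distance_matrix_index flip: sum_vertices)
    qed
    ultimately have "x \<le> 0"
      using real_symmetric_at_most_one_positive_root[OF D distance_matrix_sym _ _ e(2)] by blast
    moreover have "x \<noteq> 0" using x set_es nz by auto
    ultimately show "x < 0" by simp
  next
    have "sum_list (map inverse xs) = mat_trace ?R"
      using mat_trace_eq_sum_roots[OF R, of "map inverse xs"] inv by (simp add: o_def)
    also have "\<dots> = (\<Sum>u\<in>pverts T. distance_inverse T u u)"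
      by (simp add: mat_trace_def sum_vertices[of "\<lambda>u. distance_inverse T u u"])
    finally have "(\<Sum>x\<leftarrow>e # es. - inverse x) = - (\<Sum>u\<in>pverts T. distance_inverse T u u)"
      unfolding sum_eq using uminus_sum_list_map[of inverse xs] by (simp add: o_def)
    then show "(real n - 1) * (\<Sum>x\<leftarrow>e # es. - inverse x)
      = real n * (real n - 1) - 2 - (\<Sum>u\<in>pverts T. real (card (neighbours T u) choose 2))"
      using sum_distance_inverse_diagonal[OF tree n] by (simp only: minus_mult_commute)
  qed
qed

text \<open>\<open>c\<close> is the absolute value of the product of the eigenvalues and
  \<open>E\<close> the elementary symmetric functions of their negated reciprocals. The factor
  \<open>n - 1\<close> clears the denominator in the trace of the inverse.\<close>

lemma abs_delta_coeff:
  obtains c E where "c > 0" "\<And>k. \<bar>delta_coeff T vs k\<bar> = c * \<bar>E k\<bar>"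
    "\<And>k. k + 2 \<le> n \<Longrightarrow> E k > 0"
    "\<And>k. k + 2 \<le> n \<Longrightarrow> (real n - 1) * (real n * (real (Suc k) * E (Suc k)))
      \<le> (real n * (real n - 1) - 2 - (\<Sum>u\<in>pverts T. real (card (neighbours T u) choose 2)))
          * ((real n - real k) * E k)"
proof -
  obtain e es where cp: "char_poly (distance_matrix T vs) = (\<Prod>x\<leftarrow>e # es. [:- x, 1:])"
    and len: "length (e # es) = n" and e: "e > 0" and es: "\<And>x. x \<in> set es \<Longrightarrow> x < 0"
    and sum0: "sum_list (e # es) = 0"
    and sum: "(real n - 1) * (\<Sum>x\<leftarrow>e # es. - inverse x)
      = real n * (real n - 1) - 2 - (\<Sum>u\<in>pverts T. real (card (neighbours T u) choose 2))"
    using distance_matrix_spectrum by blast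
  define f where "f i = - inverse ((e # es) ! i)" for i
  define E where "E = coeff (esym_poly f {..<n})"
  define c where "c = \<bar>\<Prod>x\<leftarrow>e # es. - x\<bar>"
  have nz: "0 \<notin> set (e # es)"
    using e es by fastforce
  have poly: "char_poly (distance_matrix T vs) = Polynomial.smult (\<Prod>x\<leftarrow>e # es. - x) (esym_poly f {..<n})"
    using prod_linear_eq_esym_poly[OF nz] unfolding cp len f_def .
  \<comment> \<open>The positive eigenvalue heads the list, so index 0 carries the single negative
    argument.\<close>
  have f0: "f 0 < 0" using e by (simp add: f_def)
  have fpos: "f i > 0" if "i \<in> {..<n}" "i \<noteq> 0" for i
    using that len es by (cases i) (auto simp: f_def)
  have "(\<Sum>i<n. inverse (f i)) = (\<Sum>i<n. - ((e # es) ! i))"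
    by (intro sum.cong refl) (simp add: f_def)
  also have "\<dots> = - sum_list (e # es)"
    unfolding sum_negf sum_list_sum_nth len atLeast0LessThan ..
  finally have finv: "(\<Sum>i<n. inverse (f i)) = 0"
    using sum0 by simp
  have fsum: "(\<Sum>i<n. f i) = (\<Sum>x\<leftarrow>e # es. - inverse x)"
    unfolding sum_list_sum_nth length_map len atLeast0LessThan
    by (intro sum.cong refl) (use len in \<open>simp add: f_def del: list.map\<close>)
  show thesis
  proof (rule that[of c E])
    have "(\<Prod>x\<leftarrow>e # es. - x) \<noteq> 0"
      using nz by (auto simp: prod_list_zero_iff)
    then show "c > 0" by (simp add: c_def)
    show "\<bar>delta_coeff T vs k\<bar> = c * \<bar>E k\<bar>" for k
      by (simp add: delta_coeff_def distance_poly_char_poly poly c_def E_def abs_mult power_abs)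
  next
    fix k assume k: "k + 2 \<le> n"
    have k': "k + 2 \<le> card {..<n}" "0 \<in> {..<n}" using k by auto
    show "E k > 0"
      unfolding E_def using esym_poly_one_negative(1)[OF _ k'(2) f0 fpos finv k'(1)] by simp
    have "real n * (real (Suc k) * E (Suc k)) \<le> (\<Sum>i<n. f i) * ((real n - real k) * E k)"
      unfolding E_def using esym_poly_one_negative(2)[OF _ k'(2) f0 fpos finv k'(1)] by simp
    then have "(real n - 1) * (real n * (real (Suc k) * E (Suc k)))
        \<le> (real n - 1) * ((\<Sum>i<n. f i) * ((real n - real k) * E k))"
      using n by (intro mult_left_mono) auto
    then show "(real n - 1) * (real n * (real (Suc k) * E (Suc k)))
        \<le> (real n * (real n - 1) - 2 - (\<Sum>u\<in>pverts T. real (card (neighbours T u) choose 2)))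
          * ((real n - real k) * E k)"
      unfolding sum[symmetric] fsum by (simp only: mult.assoc)
  qed
qed

text \<open>A peak \<open>k\<close> beyond the bound makes the coefficients rise from
  \<open>j = k - 1\<close> to \<open>k\<close>, whereas the ratio estimate already forces a strict
  fall at \<open>j\<close>.\<close>

lemma peak_location_le:
  fixes \<rho> :: real
  assumes n3: "n \<ge> 3" and \<rho>: "\<rho> \<ge> 0" "real (num_paths2 T) \<ge> \<rho> * real ((n - 1) choose 2)"
    and peak: "peak_location (normalized_coeff T vs) (n - 2) k"
  shows "int k \<le> \<lceil>(2 - \<rho>) / (3 - \<rho>) * real n\<rceil>"
proof (rule ccontr)
  assume "\<not> int k \<le> \<lceil>(2 - \<rho>) / (3 - \<rho>) * real n\<rceil>"
  \<comment> \<open>Integrality turns \<open>k\<close> above the ceiling into a bound on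
    \<open>k - 1\<close>, the index \<open>j\<close> used below.\<close>
  then have lt: "\<lceil>(2 - \<rho>) / (3 - \<rho>) * real n\<rceil> \<le> int k - 1" by simp
  then have x: "(2 - \<rho>) / (3 - \<rho>) * real n \<le> real k - 1"
    unfolding ceiling_le_iff by simp
  let ?S = "\<Sum>u\<in>pverts T. real (card (neighbours T u) choose 2)"
  have "real (num_paths2 T) \<le> ?S"
    using num_paths2_le[OF tree] by (simp flip: of_nat_sum)
  then have S: "\<rho> * real ((n - 1) choose 2) \<le> ?S"
    using \<rho> by simp
  have choose: "real ((n - 1) choose 2) = (real n - 1) * (real n - 2) / 2"
    using n by (simp add: real_choose_two of_nat_diff)
  \<comment> \<open>No tree has more than \<open>(n - 1) choose 2\<close> paths of length 2, so
    \<open>\<rho>\<close> is at most 1 and the quotient in the bound is nonnegative.\<close>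
  have "\<rho> * real ((n - 1) choose 2) \<le> 1 * real ((n - 1) choose 2)"
    using S sum_degree_choose_two_le[OF tree n] by simp
  moreover have "real ((n - 1) choose 2) > 0"
    unfolding choose using n3 by simp
  ultimately have \<rho>1: "\<rho> \<le> 1"
    by (simp only: mult_le_cancel_right_pos)
  have "(2 - \<rho>) / (3 - \<rho>) * real n \<ge> 0"
    using \<rho>1 by simp
  with x have "k \<ge> 1" by linarith
  then obtain j where j: "k = Suc j" by (cases k) auto
  have jn: "j + 2 \<le> n" "Suc j + 2 \<le> n"
    using peak j n3 by (auto simp: peak_location_def)
  obtain c E where c: "c > 0" "\<And>k. \<bar>delta_coeff T vs k\<bar> = c * \<bar>E k\<bar>"
    and E: "\<And>k. k + 2 \<le> n \<Longrightarrow> E k > 0"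
    and ineq: "\<And>k. k + 2 \<le> n \<Longrightarrow> (real n - 1) * (real n * (real (Suc k) * E (Suc k)))
      \<le> (real n * (real n - 1) - 2 - ?S) * ((real n - real k) * E k)"
    using abs_delta_coeff by blast
  have "normalized_coeff T vs j \<le> normalized_coeff T vs (Suc j)"
    using peak j by (auto simp: peak_location_def)
  \<comment> \<open>Normalization and \<open>c\<close> cancel up to one factor 2, from the ratio of
    the powers of 2.\<close>
  then have "E j \<le> 2 * E (Suc j)"
    using c(1) E[OF jn(1)] E[OF jn(2)] by (simp add: normalized_coeff_def c(2) field_simps)
  then have "(real n - 1) * (real n * real (Suc j)) * E j
      \<le> (real n - 1) * (real n * real (Suc j)) * (2 * E (Suc j))"
    using n by (intro mult_left_mono) auto
  also have "\<dots> = 2 * ((real n - 1) * (real n * (real (Suc j) * E (Suc j))))"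
    by (simp only: mult_ac)
  also have "\<dots> \<le> 2 * ((real n * (real n - 1) - 2 - ?S) * ((real n - real j) * E j))"
    using ineq[OF jn(1)] by simp
  \<comment> \<open>Replacing \<open>?S\<close> by its lower bound enlarges the factor.\<close>
  also have "\<dots> \<le> 2 * ((real n * (real n - 1) - 2 - \<rho> * ((real n - 1) * (real n - 2) / 2)) * ((real n - real j) * E j))"
    using S E[OF jn(1)] jn unfolding choose by (intro mult_left_mono mult_right_mono) auto
  also have "\<dots> = 2 * (real n * (real n - 1) - 2 - \<rho> * ((real n - 1) * (real n - 2) / 2)) * (real n - real j) * E j"
    by (simp only: mult_ac)
  also have "\<dots> < (real n - 1) * real n * (real j + 1) * E j"
    using n3 \<rho> \<rho>1 x jn j E[OF jn(1)]
    by (intro mult_strict_right_mono peak_index_arithmetic) auto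
  finally show False by (simp add: mult.assoc add.commute)
qed

end

theorem theorem3p3:
  fixes T :: "'a pair_pre_digraph" and vs :: "'a list" and n :: nat
  assumes "undirected_tree T"
    and "distinct vs" and "set vs = pverts T"
    and "card (pverts T) = n" and "n \<ge> 2"
  shows "(n \<ge> 3 \<longrightarrow>
           (\<forall>\<rho>::real. \<rho> \<ge> 0 \<and> real (num_paths2 T) \<ge> \<rho> * real ((n - 1) choose 2) \<longrightarrow>
             (\<forall>k. peak_location (normalized_coeff T vs) (n - 2) k \<longrightarrow>
                int k \<le> \<lceil>(2 - \<rho>) / (3 - \<rho>) * real n\<rceil>)))
         \<and> (\<forall>k. peak_location (normalized_coeff T vs) (n - 2) k \<longrightarrow>
                int k \<le> \<lceil>2 / 3 * real n\<rceil>)"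
proof (intro conjI impI allI)
  fix \<rho> :: real and k
  assume "3 \<le> n" "\<rho> \<ge> 0 \<and> real (num_paths2 T) \<ge> \<rho> * real ((n - 1) choose 2)"
    "peak_location (normalized_coeff T vs) (n - 2) k"
  then show "int k \<le> \<lceil>(2 - \<rho>) / (3 - \<rho>) * real n\<rceil>"
    using peak_location_le[OF assms] by blast
next
  fix k assume peak: "peak_location (normalized_coeff T vs) (n - 2) k"
  show "int k \<le> \<lceil>2 / 3 * real n\<rceil>"
  \<comment> \<open>For two vertices the sequence consists of the single term at 0; otherwise
    \<open>\<rho> = 0\<close> applies.\<close>
  proof (cases "n = 2")
    case True
    then have "k = 0" using peak by (simp add: peak_location_def)
    then show ?thesis by simp
  next
    case False
    then have "n \<ge> 3" using assms(5) by simp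
    then show ?thesis
      using peak_location_le[OF assms _ _ _ peak, of 0] by simp
  qed
qed

end
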